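(* Let $m_1,m_2,\lambda_1,\lambda_2\in(0,\infty)$ and $\alpha_1,\alpha_2\in[0,1)$, let $X\sim \mathrm{TSD}(m_1,\alpha_1,\lambda_1,m_2,\alpha_2,\lambda_2)$ with characteristic function $\phi_{ts}$, and for each $n\ge 1$ let $X_n$ be a compound Poisson random variable with characteristic function $$\phi_n(z)=\exp\Big(n\big(\phi_{ts}^{1/n}(z)-1\big)\Big),\qquad z\in\mathbb{R}.$$ Then there is a constant $c>0$, independent of $n$, such that for all $n\ge 1$ $$d_K(X_n,X)\le c\,\Big(\sum_{j=1}^{2}|C_j(X)|\Big)^{2/5}\Big(\frac1n\Big)^{1/5},$$ where $C_j(X)$ denotes the $j$-th cumulant of $X$.
   Context: Tempered stable distribution: $X\sim \mathrm{TSD}(m_1,\alpha_1,\lambda_1,m_2,\alpha_2,\lambda_2)$ (with $m_i,\lambda_i\in(0,\infty)$, $\alpha_i\in[0,1)$, $i=1,2$) means that $X$ is a real random variable with characteristic function $$\phi_{ts}(z)=\mathbb{E}(e^{izX})=\exp\Big(\int_{\mathbb{R}}(e^{izu}-1)\,\nu_{ts}(du)\Big),\quad z\in\mathbb{R},$$ where $$\nu_{ts}(du)=\Big(\frac{m_1}{u^{1+\alpha_1}}e^{-\lambda_1u}\mathbf 1_{(0,\infty)}(u)+\frac{m_2}{|u|^{1+\alpha_2}}e^{-\lambda_2|u|}\mathbf 1_{(-\infty,0)}(u)\Big)du.$$ Here $\phi_{ts}^{1/n}(z)=\exp\big(\frac1n\int_{\mathbb{R}}(e^{izu}-1)\nu_{ts}(du)\big)$.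 Cumulants: $C_n(X)=(-i)^n\big[\frac{d^n}{dz^n}\log\phi_{ts}(z)\big]_{z=0}=\int_{\mathbb{R}}u^n\,\nu_{ts}(du)$, $n\ge1$; in particular $C_1(X)=\mathbb{E}(X)$ and $C_2(X)=\mathrm{Var}(X)$. Kolmogorov distance: $d_K(Y,Z)=\sup_{x\in\mathbb{R}}|\mathbb{P}(Y\le x)-\mathbb{P}(Z\le x)|$. *)

theory Defs
  imports "HOL-Probability.Probability"
begin

text \<open>The tempering parameters \<open>\<lambda>\<^sub>1\<close>, \<open>\<lambda>\<^sub>2\<close> are written \<open>l1\<close>, \<open>l2\<close>.\<close>
definition ts_levy_density ::
    "real \<Rightarrow> real \<Rightarrow> real \<Rightarrow> real \<Rightarrow> real \<Rightarrow> real \<Rightarrow> real \<Rightarrow> real" where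
  "ts_levy_density m1 \<alpha>1 l1 m2 \<alpha>2 l2 u =
     m1 / u powr (1 + \<alpha>1) * exp (- l1 * u) * indicator {0<..} u +
     m2 / \<bar>u\<bar> powr (1 + \<alpha>2) * exp (- l2 * \<bar>u\<bar>) * indicator {..<0} u"

definition ts_levy_measure ::
    "real \<Rightarrow> real \<Rightarrow> real \<Rightarrow> real \<Rightarrow> real \<Rightarrow> real \<Rightarrow> real measure" where
  "ts_levy_measure m1 \<alpha>1 l1 m2 \<alpha>2 l2 =
     density lborel (\<lambda>u. ennreal (ts_levy_density m1 \<alpha>1 l1 m2 \<alpha>2 l2 u))"

definition ts_exponent ::
    "real \<Rightarrow> real \<Rightarrow> real \<Rightarrow> real \<Rightarrow> real \<Rightarrow> real \<Rightarrow> real \<Rightarrow> complex" where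
  "ts_exponent m1 \<alpha>1 l1 m2 \<alpha>2 l2 z =
     (CLINT u|ts_levy_measure m1 \<alpha>1 l1 m2 \<alpha>2 l2. iexp (z * u) - 1)"

definition has_TSD ::
    "'a measure \<Rightarrow> ('a \<Rightarrow> real) \<Rightarrow> real \<Rightarrow> real \<Rightarrow> real \<Rightarrow> real \<Rightarrow> real \<Rightarrow> real \<Rightarrow> bool" where
  "has_TSD M X m1 \<alpha>1 l1 m2 \<alpha>2 l2 \<longleftrightarrow>
     X \<in> borel_measurable M \<and>
     (\<forall>z. char (distr M borel X) z = exp (ts_exponent m1 \<alpha>1 l1 m2 \<alpha>2 l2 z))"

text \<open>The root of the characteristic function is the one given by the exponent,
  not by a branch of the complex power function.\<close>
definition ts_char_root ::
    "nat \<Rightarrow> real \<Rightarrow> real \<Rightarrow> real \<Rightarrow> real \<Rightarrow> real \<Rightarrow> real \<Rightarrow> real \<Rightarrow> complex" where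
  "ts_char_root n m1 \<alpha>1 l1 m2 \<alpha>2 l2 z =
     exp (1 / of_nat n * ts_exponent m1 \<alpha>1 l1 m2 \<alpha>2 l2 z)"

text \<open>The law of \<open>Y\<^sub>0 + \<dots> + Y\<^sub>N\<^sub>-\<^sub>1\<close>, where \<open>N\<close> is Poisson with rate \<open>r\<close> and the \<open>Y\<^sub>i\<close>
  are i.i.d. with law \<open>F\<close> and independent of \<open>N\<close>.\<close>
definition compound_poisson_law :: "real \<Rightarrow> real measure \<Rightarrow> real measure" where
  "compound_poisson_law r F =
     measure_pmf (poisson_pmf r) \<bind>
       (\<lambda>k. distr (PiM {..<k} (\<lambda>_. F)) borel (\<lambda>y. \<Sum>i<k. y i))"

definition compound_poisson_rv :: "'a measure \<Rightarrow> ('a \<Rightarrow> real) \<Rightarrow> bool" where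
  "compound_poisson_rv M X \<longleftrightarrow>
     X \<in> borel_measurable M \<and>
     (\<exists>r F. r > 0 \<and> real_distribution F \<and> distr M borel X = compound_poisson_law r F)"

text \<open>Only the germ at \<open>0\<close> matters, and there (since \<open>\<phi>(0) = 1\<close>) the principal logarithm
  agrees with the continuous logarithm of \<open>\<phi>\<close> that vanishes at \<open>0\<close>.
  The argument \<open>z\<close> is real, hence \<open>vector_derivative\<close> rather than \<open>deriv\<close>.\<close>
definition cumulant :: "'a measure \<Rightarrow> ('a \<Rightarrow> real) \<Rightarrow> nat \<Rightarrow> complex" where
  "cumulant M X n =
     (- \<i>) ^ n *
     ((\<lambda>f z. vector_derivative f (at z)) ^^ n) (\<lambda>z::real. Ln (char (distr M borel X) z)) 0"

definition kolmogorov_dist ::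
    "'a measure \<Rightarrow> ('a \<Rightarrow> real) \<Rightarrow> 'b measure \<Rightarrow> ('b \<Rightarrow> real) \<Rightarrow> real" where
  "kolmogorov_dist M Y N Z =
     (SUP x. \<bar>cdf (distr M borel Y) x - cdf (distr N borel Z) x\<bar>)"

end

theory Submission
  imports Defs "HOL-Real_Asymp.Real_Asymp"
begin

text \<open>Write \<open>\<phi> = exp \<psi>\<close> for the characteristic function of \<open>X\<close>. As \<open>Re \<psi> \<le> 0\<close>, the characteristic
  functions of \<open>X\<^sub>n\<close> and \<open>X\<close> differ by at most \<open>\<bar>\<psi>\<bar>\<^sup>2 / n\<close>. For a suitable \<open>a \<in> (0, 1/2]\<close> one has
  both \<open>\<bar>\<psi> z\<bar> \<le> P \<bar>z\<bar>\<^bsup>2a\<^esup>\<close> and \<open>\<bar>\<phi> z\<bar> \<le> K \<bar>z\<bar>\<^bsup>-a\<^esup>\<close>; the second bound makes the distribution function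
  of \<open>X\<close> Hoelder continuous with exponent \<open>a\<close>, even when its density is unbounded. Gaussian smoothing
  at scale \<open>\<sigma>\<close> then gives \<open>d\<^sub>K = O(\<sigma>\<^bsup>-4a\<^esup> / n + \<sigma>\<^bsup>a\<^esup>)\<close>, and \<open>\<sigma> = n\<^bsup>-1/(5a)\<^esup>\<close> balances both terms
  at \<open>n\<^bsup>-1/5\<^esup>\<close>. The sum of the cumulants is a positive constant because \<open>C\<^sub>2(X) > 0\<close>.\<close>

subsection \<open>Elementary estimates\<close>

text \<open>Interpolates between the bounds \<open>\<bar>x\<bar>\<close>, sharp near 0, and 2, sharp
  far out. The free exponent \<open>p\<close> is later matched to the integrability of the Levy
  measure at 0.\<close>

lemma cmod_iexp_minus_one_le_powr:
  assumes "0 < p" "p \<le> 1"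
  shows "cmod (iexp x - 1) \<le> 2 * \<bar>x\<bar> powr p"
proof (cases "\<bar>x\<bar> \<le> 1")
  case True
  have "cmod (iexp x - 1) \<le> \<bar>x\<bar>"
    using iexp_approx1[of x 0] by simp
  also have "\<bar>x\<bar> \<le> \<bar>x\<bar> powr p"
    using powr_mono'[of p 1 "\<bar>x\<bar>"] assms True by simp
  finally show ?thesis
    using powr_ge_zero[of "\<bar>x\<bar>" p] by linarith
next
  case False
  have "cmod (iexp x - 1) \<le> 2"
    using iexp_approx2[of x 0] by simp
  moreover have "1 \<le> \<bar>x\<bar> powr p"
    using False assms by (intro ge_one_powr_ge_zero) auto
  ultimately show ?thesis by linarith
qed

text \<open>A two-sided Gamma integral, rescaled by \<open>l\<close>. It is the source of
  integrability both for the tempered Levy densities and for powers under the normal law.\<close>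

lemma integrable_powr_exp:
  fixes s l :: real
  assumes "s > 0" "l > 0"
  shows "integrable lborel (\<lambda>u. \<bar>u\<bar> powr (s - 1) * exp (- l * \<bar>u\<bar>))"
proof -
  define f where "f = (\<lambda>t::real. indicator {0..} t * t powr (s - 1) / exp t)"
  have "integrable lborel f"
  proof (rule integrableI_nonneg)
    show "(\<integral>\<^sup>+ x. ennreal (f x) \<partial>lborel) < \<infinity>"
      using Gamma_conv_nn_integral_real[OF assms(1), symmetric] by (simp add: f_def)
  qed (auto simp: f_def)
  then have f: "integrable lborel (\<lambda>u. f (l * u))"
    using lborel_integrable_real_affine[of f l 0] assms by simp
  have "integrable lborel (\<lambda>u. (1 / l) powr (s - 1) * (f (l * u) + f (l * (- u))))"
    using lborel_integrable_real_affine[OF f, of "-1" 0] f by (intro integrable_mult_right integrable_add) auto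
  \<comment> \<open>\<open>f\<close> vanishes on the negative half-line, so adding the reflected
    copy yields the even extension. At \<open>u = 0\<close> both sides are 0 because
    \<open>0 powr x = 0\<close>.\<close>
  moreover have "(1 / l) powr (s - 1) * (f (l * u) + f (l * (- u))) = \<bar>u\<bar> powr (s - 1) * exp (- l * \<bar>u\<bar>)" for u
    using assms
    by (cases "u = 0"; cases "u > 0")
       (auto simp: f_def indicator_def powr_mult powr_divide exp_minus field_simps zero_le_mult_iff mult_le_0_iff
         powr_mult[of l "-u", simplified])
  ultimately show ?thesis by (simp only:)
qed

lemma levy_exponent_powr_bound:
  assumes [measurable_cong]: "sets \<nu> = sets borel"
    and p: "0 < p" "p \<le> 1"
    and int: "integrable \<nu> (\<lambda>u. \<bar>u\<bar> powr p)"
  shows "integrable \<nu> (\<lambda>u. iexp (z * u) - 1)"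
    and "cmod (CLINT u|\<nu>. iexp (z * u) - 1) \<le> 2 * (LINT u|\<nu>. \<bar>u\<bar> powr p) * \<bar>z\<bar> powr p"
proof -
  have le: "cmod (iexp (z * u) - 1) \<le> 2 * \<bar>z\<bar> powr p * \<bar>u\<bar> powr p" for u
    using cmod_iexp_minus_one_le_powr[OF p, of "z * u"] by (simp add: abs_mult powr_mult)
  have int': "integrable \<nu> (\<lambda>u. 2 * \<bar>z\<bar> powr p * \<bar>u\<bar> powr p)"
    using int by simp
  show int2: "integrable \<nu> (\<lambda>u. iexp (z * u) - 1)"
    by (rule Bochner_Integration.integrable_bound[OF int']) (use le in auto)
  have "cmod (CLINT u|\<nu>. iexp (z * u) - 1) \<le> (LINT u|\<nu>. 2 * \<bar>z\<bar> powr p * \<bar>u\<bar> powr p)"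
    by (rule Bochner_Integration.integral_norm_bound_integral[OF int2 int']) (rule le)
  then show "cmod (CLINT u|\<nu>. iexp (z * u) - 1) \<le> 2 * (LINT u|\<nu>. \<bar>u\<bar> powr p) * \<bar>z\<bar> powr p"
    by (simp add: mult_ac)
qed

text \<open>Integrating \<open>cos v / v\<close> by parts shows that the derivative of
  \<open>ln v - sin v / v + 1 / v\<close> is at most \<open>(1 - cos v) / v\<close>.\<close>

lemma integral_one_minus_cos_ge_ln:
  fixes z \<delta> :: real
  assumes "z > 0" "1 \<le> \<delta> * z"
  shows "ln (\<delta> * z) - 1 \<le> (LINT u|lborel. (1 - cos (z * u)) / u * indicator {1 / z..\<delta>} u)"
proof -
  define H where "H = (\<lambda>v::real. ln v - sin v / v + 1 / v)"
  define h where "h = (\<lambda>v::real. 1 / v - cos v / v + sin v / v\<^sup>2 - 1 / v\<^sup>2)"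
  have "\<delta> > 0" using assms by (smt (verit) mult_nonneg_nonpos2)
  have le: "1 / z \<le> \<delta>" using assms by (simp add: field_simps)
  have pos: "u > 0" if "1 / z \<le> u" for u
    using that assms by (smt (verit) divide_pos_pos)
  have deriv: "((\<lambda>u. H (z * u)) has_real_derivative z * h (z * u)) (at u)" if "1 / z \<le> u" for u
    unfolding H_def h_def using pos[OF that] assms
    by (auto intro!: derivative_eq_intros simp: field_simps power2_eq_square)
  have cont: "isCont (\<lambda>u. z * h (z * u)) u" if "1 / z \<le> u" for u
    unfolding h_def using pos[OF that] assms by (intro continuous_intros) auto
  have 1: "(LINT u|lborel. z * h (z * u) * indicator {1 / z..\<delta>} u) = H (z * \<delta>) - H (z * (1 / z))"
    by (rule integral_FTC_Icc_real[OF le]) (use deriv cont in auto)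
  have "continuous_on {1 / z..\<delta>} (\<lambda>u. z * h (z * u))"
    using cont by (auto intro!: continuous_at_imp_continuous_on)
  then have 2: "integrable lborel (\<lambda>u. z * h (z * u) * indicator {1 / z..\<delta>} u)"
    using borel_integrable_atLeastAtMost'[of "1/z" \<delta> "\<lambda>u. z * h (z * u)"]
    by (simp add: set_integrable_def mult.commute)
  have 3: "integrable lborel (\<lambda>u. (1 - cos (z * u)) / u * indicator {1 / z..\<delta>} u)"
  proof -
    have "continuous_on {1 / z..\<delta>} (\<lambda>u. (1 - cos (z * u)) / u)"
      using pos by (intro continuous_intros) force+
    then show ?thesis
      using borel_integrable_atLeastAtMost'[of "1/z" \<delta> "\<lambda>u. (1 - cos (z * u)) / u"]
      by (simp add: set_integrable_def mult.commute)
  qed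
  have "H (z * \<delta>) - H (z * (1 / z)) \<le> (LINT u|lborel. (1 - cos (z * u)) / u * indicator {1 / z..\<delta>} u)"
    unfolding 1[symmetric]
  proof (rule integral_mono[OF 2 3])
    fix u
    have "z * h (z * u) \<le> (1 - cos (z * u)) / u" if "1 / z \<le> u"
    proof -
      have "z * h (z * u) = (1 - cos (z * u)) / u - (1 - sin (z * u)) / (z * u\<^sup>2)"
        unfolding h_def using pos[OF that] assms by (simp add: field_simps power2_eq_square)
      moreover have "(1 - sin (z * u)) / (z * u\<^sup>2) \<ge> 0"
        using assms by simp
      ultimately show ?thesis by linarith
    qed
    then show "z * h (z * u) * indicator {1 / z..\<delta>} u \<le> (1 - cos (z * u)) / u * indicator {1 / z..\<delta>} u"
      by (auto simp: indicator_def)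
  qed
  moreover have "H (z * \<delta>) \<ge> ln (\<delta> * z)"
  proof -
    have "sin (z * \<delta>) / (z * \<delta>) \<le> 1 / (z * \<delta>)"
      using assms \<open>\<delta> > 0\<close> by (intro divide_right_mono) auto
    then show ?thesis by (simp add: H_def mult.commute)
  qed
  \<comment> \<open>The value is \<open>H 1 = 1 - sin 1\<close>; this is where the constant -1 in
    the statement comes from.\<close>
  moreover have "H (z * (1 / z)) \<le> 1"
    using assms sin_ge_zero[of 1] pi_gt3 by (simp add: H_def)
  ultimately show ?thesis by linarith
qed

subsection \<open>The Levy exponent and the cumulants\<close>

text \<open>Differentiation under the integral sign by a Taylor remainder: the error is at most
  \<open>(y - z)\<^sup>2\<close> times the integral of \<open>u\<^sup>2 * \<bar>g u\<bar>\<close>.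
  The choice \<open>k = 1\<close>, \<open>g = 1\<close> treats the exponent, whose Levy measure may
  be infinite, so that the subtraction of 1 cannot be split off; \<open>k = 0\<close> treats its
  derivative.\<close>

lemma has_vector_derivative_fourier_integral:
  fixes g :: "real \<Rightarrow> complex" and k :: complex
  assumes [measurable_cong]: "sets \<nu> = sets borel"
    and [measurable]: "g \<in> borel_measurable borel"
    and int0: "\<And>z. integrable \<nu> (\<lambda>u. (iexp (z * u) - k) * g u)"
    and int1: "integrable \<nu> (\<lambda>u. of_real u * g u)"
    and int2: "integrable \<nu> (\<lambda>u. of_real (u\<^sup>2) * g u)"
  shows "((\<lambda>z. CLINT u|\<nu>. (iexp (z * u) - k) * g u) has_vector_derivative
          (CLINT u|\<nu>. iexp (z * u) * (\<i> * of_real u * g u))) (at z)"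
proof -
  define F where "F = (\<lambda>z. CLINT u|\<nu>. (iexp (z * u) - k) * g u)"
  define D where "D = (CLINT u|\<nu>. iexp (z * u) * (\<i> * of_real u * g u))"
  define B where "B = (LINT u|\<nu>. cmod (of_real (u\<^sup>2) * g u))"
  have intD: "integrable \<nu> (\<lambda>u. iexp (z * u) * (\<i> * of_real u * g u))"
    by (rule Bochner_Integration.integrable_bound[OF int1]) (auto simp: norm_mult)
  have bound: "cmod (F y - F z - (y - z) *\<^sub>R D) \<le> B * (y - z)\<^sup>2" for y
  proof -
    let ?r = "\<lambda>u. (iexp (y * u) - k) * g u - (iexp (z * u) - k) * g u
                 - (y - z) *\<^sub>R (iexp (z * u) * (\<i> * of_real u * g u))"
    have le: "cmod (?r u) \<le> (y - z)\<^sup>2 * cmod (of_real (u\<^sup>2) * g u)" for u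
    proof -
      let ?h = "(y - z) * u"
      have "iexp (y * u) = iexp (z * u) * iexp ?h"
        by (simp add: exp_add[symmetric] algebra_simps)
      then have "?r u = iexp (z * u) * g u * (iexp ?h - 1 - \<i> * of_real ?h)"
        by (simp add: algebra_simps scaleR_conv_of_real)
      then have "cmod (?r u) = cmod (g u) * cmod (iexp ?h - 1 - \<i> * of_real ?h)"
        by (simp add: norm_mult)
      also have "\<dots> \<le> cmod (g u) * ?h\<^sup>2"
      proof (intro mult_left_mono)
        have "cmod (iexp ?h - 1 - \<i> * of_real ?h) \<le> \<bar>?h\<bar>\<^sup>2 / 2"
          using iexp_approx1[of ?h 1] by (simp add: numeral_2_eq_2 diff_diff_eq)
        then show "cmod (iexp ?h - 1 - \<i> * of_real ?h) \<le> ?h\<^sup>2"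
          using zero_le_power2[of ?h] by (simp only: power2_abs)
      qed auto
      finally show ?thesis by (simp add: norm_mult power_mult_distrib norm_power mult_ac)
    qed
    note intyz = Bochner_Integration.integrable_diff[OF int0[of y] int0[of z]]
    have intD': "integrable \<nu> (\<lambda>u. (y - z) *\<^sub>R (iexp (z * u) * (\<i> * of_real u * g u)))"
      using intD by (rule integrable_scaleR_right)
    have "F y - F z - (y - z) *\<^sub>R D = (CLINT u|\<nu>. ?r u)"
      unfolding F_def D_def
      by (simp only: Bochner_Integration.integral_diff[OF intyz intD']
          Bochner_Integration.integral_diff[OF int0 int0] integral_scaleR_right)
    also have "cmod \<dots> \<le> (LINT u|\<nu>. (y - z)\<^sup>2 * cmod (of_real (u\<^sup>2) * g u))"
      by (rule Bochner_Integration.integral_norm_bound_integral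
          [OF Bochner_Integration.integrable_diff[OF intyz intD'] integrable_mult_right[OF integrable_norm[OF int2]] le])
    finally show ?thesis by (simp add: B_def mult.commute)
  qed
  have "(F has_derivative (\<lambda>h. h *\<^sub>R D)) (at z)"
    unfolding has_derivative_at
  proof (intro conjI)
    show "bounded_linear (\<lambda>h. h *\<^sub>R D)" by (rule bounded_linear_scaleR_left)
    have "cmod (F (z + h) - F z - h *\<^sub>R D) / \<bar>h\<bar> \<le> B * \<bar>h\<bar>" for h
      using bound[of "z + h"] by (cases "h = 0") (auto simp: field_simps power2_eq_square)
    moreover have "(\<lambda>h. B * \<bar>h\<bar>) \<midarrow>0\<rightarrow> 0"
      by (intro tendsto_mult_right_zero tendsto_rabs_zero tendsto_ident_at)
    ultimately show "(\<lambda>h. norm (F (z + h) - F z - h *\<^sub>R D) / norm h) \<midarrow>0\<rightarrow> 0"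
      by (elim Lim_null_comparison[OF always_eventually[OF allI], rotated])
         (simp only: real_norm_def abs_divide abs_norm_cancel abs_abs)
  qed
  then show ?thesis
    by (simp add: has_vector_derivative_def F_def D_def)
qed

section \<open>Moments of the tempered stable Levy measure and the second cumulant\<close>

lemma measurable_ts_levy_density [measurable]:
  "ts_levy_density m1 \<alpha>1 l1 m2 \<alpha>2 l2 \<in> borel_measurable borel"
  unfolding ts_levy_density_def by measurable

lemma sets_ts_levy_measure [simp, measurable_cong]:
  "sets (ts_levy_measure m1 \<alpha>1 l1 m2 \<alpha>2 l2) = sets borel"
  by (simp add: ts_levy_measure_def)

lemma ts_levy_density_nonneg:
  "m1 > 0 \<Longrightarrow> m2 > 0 \<Longrightarrow> 0 \<le> ts_levy_density m1 \<alpha>1 l1 m2 \<alpha>2 l2 u"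
  by (simp add: ts_levy_density_def)

text \<open>On each half-line the integrand is \<open>\<bar>u\<bar> powr (p - \<alpha> - 1)\<close>
  times the tempering factor up to a constant, so \<open>p > \<alpha>\<close> settles the
  singularity at 0 and the tempering settles infinity.\<close>

lemma integrable_ts_levy_measure_powr:
  assumes "m1 > 0" "m2 > 0" "l1 > 0" "l2 > 0" "p > \<alpha>1" "p > \<alpha>2"
  shows "integrable (ts_levy_measure m1 \<alpha>1 l1 m2 \<alpha>2 l2) (\<lambda>u. \<bar>u\<bar> powr p)"
proof -
  let ?w = "\<lambda>\<alpha> l u. \<bar>u\<bar> powr (p - \<alpha> - 1) * exp (- l * \<bar>u\<bar>) :: real"
  let ?d = "ts_levy_density m1 \<alpha>1 l1 m2 \<alpha>2 l2"
  have "integrable lborel (\<lambda>u. m1 * ?w \<alpha>1 l1 u + m2 * ?w \<alpha>2 l2 u)"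
    using assms by (intro Bochner_Integration.integrable_add integrable_mult_right integrable_powr_exp) auto
  then have "integrable lborel (\<lambda>u. ?d u *\<^sub>R \<bar>u\<bar> powr p)"
  proof (rule Bochner_Integration.integrable_bound)
    have "norm (?d u *\<^sub>R \<bar>u\<bar> powr p) \<le> m1 * ?w \<alpha>1 l1 u + m2 * ?w \<alpha>2 l2 u" for u
    proof -
      have split: "x powr p / x powr (1 + \<alpha>) = x powr (p - \<alpha> - 1)" for x \<alpha> :: real
        using powr_diff[of x p "1 + \<alpha>"] by (simp add: algebra_simps)
      have "?d u * \<bar>u\<bar> powr p = m1 * ?w \<alpha>1 l1 u * indicator {0<..} u + m2 * ?w \<alpha>2 l2 u * indicator {..<0} u"
        by (auto simp: ts_levy_density_def indicator_def split[symmetric])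
      then show ?thesis
        using assms by (auto simp: indicator_def)
    qed
    then show "AE u in lborel. norm (?d u *\<^sub>R \<bar>u\<bar> powr p) \<le> norm (m1 * ?w \<alpha>1 l1 u + m2 * ?w \<alpha>2 l2 u)"
      using assms by (intro AE_I2) (smt (verit) real_norm_def)
  qed simp
  then show ?thesis
    unfolding ts_levy_measure_def
    by (subst integrable_density) (use assms in \<open>auto simp: ts_levy_density_nonneg\<close>)
qed

lemma integrable_ts_levy_measure_power:
  assumes "m1 > 0" "m2 > 0" "l1 > 0" "l2 > 0" "\<alpha>1 < 1" "\<alpha>2 < 1" "k \<ge> 1"
  shows "integrable (ts_levy_measure m1 \<alpha>1 l1 m2 \<alpha>2 l2) (\<lambda>u. complex_of_real (u ^ k))"
proof (rule Bochner_Integration.integrable_bound)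
  show "integrable (ts_levy_measure m1 \<alpha>1 l1 m2 \<alpha>2 l2) (\<lambda>u. \<bar>u\<bar> powr k)"
    using assms by (intro integrable_ts_levy_measure_powr) auto
  show "AE u in ts_levy_measure m1 \<alpha>1 l1 m2 \<alpha>2 l2. norm (complex_of_real (u ^ k)) \<le> norm (\<bar>u\<bar> powr k)"
  proof (intro AE_I2)
    fix u :: real
    have "\<bar>u\<bar> ^ k = \<bar>u\<bar> powr k"
      using assms by (cases "u = 0") (auto simp: powr_realpow)
    then show "norm (complex_of_real (u ^ k)) \<le> norm (\<bar>u\<bar> powr k)"
      by (simp add: norm_power)
  qed
qed (measurable; simp)

text \<open>The density is positive on the unit interval, which has positive Lebesgue measure, so
  \<open>u\<^sup>2\<close> cannot vanish almost everywhere for the Levy measure.\<close>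

lemma ts_second_moment_pos:
  assumes "m1 > 0" "m2 > 0" "l1 > 0" "l2 > 0" "\<alpha>1 < 1" "\<alpha>2 < 1"
  shows "0 < (LINT u|ts_levy_measure m1 \<alpha>1 l1 m2 \<alpha>2 l2. u\<^sup>2)"
proof -
  let ?\<nu> = "ts_levy_measure m1 \<alpha>1 l1 m2 \<alpha>2 l2"
  let ?d = "ts_levy_density m1 \<alpha>1 l1 m2 \<alpha>2 l2"
  have int: "integrable ?\<nu> (\<lambda>u. u\<^sup>2)"
    using integrable_ts_levy_measure_power[OF assms, of 2] by (simp only: complex_of_real_integrable_eq)
  have "(LINT u|?\<nu>. u\<^sup>2) \<noteq> 0"
  proof
    assume "(LINT u|?\<nu>. u\<^sup>2) = 0"
    then have "AE u in ?\<nu>. u\<^sup>2 = 0"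
      using integral_nonneg_eq_0_iff_AE[OF int] by simp
    then have "AE u in lborel. 0 < ?d u \<longrightarrow> u = 0"
      unfolding ts_levy_measure_def by (subst (asm) AE_density) auto
    then have "AE u in lborel. u \<notin> {0<..<1::real}"
      by eventually_elim (use assms in \<open>auto simp: ts_levy_density_def\<close>)
    then have "emeasure lborel {0<..<1::real} = 0"
      by (subst (asm) AE_iff_measurable[of "{0<..<1}"]) auto
    then show False by simp
  qed
  moreover have "0 \<le> (LINT u|?\<nu>. u\<^sup>2)" by simp
  ultimately show ?thesis by linarith
qed

lemma cumulant_2_TSD:
  assumes "m1 > 0" "m2 > 0" "l1 > 0" "l2 > 0" "\<alpha>1 < 1" "\<alpha>2 < 1"
    and "has_TSD M X m1 \<alpha>1 l1 m2 \<alpha>2 l2"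
  shows "cumulant M X 2 = of_real (LINT u|ts_levy_measure m1 \<alpha>1 l1 m2 \<alpha>2 l2. u\<^sup>2)"
proof -
  let ?\<nu> = "ts_levy_measure m1 \<alpha>1 l1 m2 \<alpha>2 l2"
  let ?L = "\<lambda>z. Ln (char (distr M borel X) z)"
  define \<psi> where "\<psi> = ts_exponent m1 \<alpha>1 l1 m2 \<alpha>2 l2"
  define \<psi>' where "\<psi>' = (\<lambda>z. CLINT u|?\<nu>. iexp (z * u) * (\<i> * of_real u))"
  note pow = integrable_ts_levy_measure_power[OF assms(1-6)]
  have mom: "integrable ?\<nu> (\<lambda>u. complex_of_real u)"
    "integrable ?\<nu> (\<lambda>u. complex_of_real (u\<^sup>2))" "integrable ?\<nu> (\<lambda>u. complex_of_real (u^3))"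
    using pow[of 1] pow[of 2] pow[of 3] by simp_all
  have "integrable ?\<nu> (\<lambda>u. \<bar>u\<bar> powr 1)"
    using assms by (intro integrable_ts_levy_measure_powr) auto
  note int0 = levy_exponent_powr_bound(1)[OF sets_ts_levy_measure _ _ this]
  have d1: "(\<psi> has_vector_derivative \<psi>' z) (at z)" for z
    using has_vector_derivative_fourier_integral[of ?\<nu> "\<lambda>_. 1" 1 z] mom int0
    by (simp add: \<psi>_def \<psi>'_def ts_exponent_def[abs_def])
  have "integrable ?\<nu> (\<lambda>u. iexp (z * u) * (\<i> * of_real u))" for z
    by (rule Bochner_Integration.integrable_bound[OF mom(1)]) (auto simp: norm_mult)
  moreover have "integrable ?\<nu> (\<lambda>u. \<i> * complex_of_real (u\<^sup>2))" "integrable ?\<nu> (\<lambda>u. \<i> * complex_of_real (u^3))"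
    using mom by simp_all
  \<comment> \<open>The weight is now \<open>\<i> * u\<close>, and the remainder estimate asks for
    two further powers of \<open>u\<close>, hence for the third moment.\<close>
  ultimately have "(\<psi>' has_vector_derivative (CLINT u|?\<nu>. iexp (0 * u) * (\<i> * of_real u * (\<i> * of_real u)))) (at 0)"
    unfolding \<psi>'_def
    using has_vector_derivative_fourier_integral[of ?\<nu> "\<lambda>u. \<i> * of_real u" 0 0]
    by (simp add: power2_eq_square power3_eq_cube mult.left_commute mult.assoc)
  moreover have "(CLINT u|?\<nu>. iexp (0 * u) * (\<i> * of_real u * (\<i> * of_real u))) = - of_real (LINT u|?\<nu>. u\<^sup>2)"
  proof -
    have "(\<lambda>u::real. iexp (0 * u) * (\<i> * of_real u * (\<i> * of_real u))) = (\<lambda>u. - complex_of_real (u\<^sup>2))"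
      by (simp add: fun_eq_iff power2_eq_square mult.left_commute mult.assoc)
    then show ?thesis
      by (simp only: Bochner_Integration.integral_minus integral_complex_of_real)
  qed
  ultimately have d2: "(\<psi>' has_vector_derivative - of_real (LINT u|?\<nu>. u\<^sup>2)) (at 0)" by simp
  \<comment> \<open>On this open neighbourhood of 0 the exponent stays in the strip where
    \<open>Ln\<close> inverts \<open>exp\<close>, so the principal logarithm of the characteristic
    function is \<open>\<psi>\<close> itself.\<close>
  define S where "S = {z. cmod (\<psi> z) < pi}"
  have "continuous_on UNIV \<psi>"
    by (intro continuous_at_imp_continuous_on ballI has_vector_derivative_continuous[OF d1])
  then have S: "open S"
    unfolding S_def by (intro open_Collect_less continuous_intros)
  have S0: "0 \<in> S" by (simp add: S_def \<psi>_def ts_exponent_def)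
  have L: "?L z = \<psi> z" if "z \<in> S" for z
  proof -
    have "\<bar>Im (\<psi> z)\<bar> < pi"
      using that abs_Im_le_cmod[of "\<psi> z"] by (simp add: S_def)
    then have "Ln (exp (\<psi> z)) = \<psi> z" by (intro Ln_exp) auto
    then show ?thesis using assms(7) by (simp add: has_TSD_def \<psi>_def)
  qed
  \<comment> \<open>The first derivative is identified on all of \<open>S\<close>, not only at 0,
    because the second derivative at 0 depends on its germ.\<close>
  have "vector_derivative ?L (at z) = \<psi>' z" if "z \<in> S" for z
    by (rule vector_derivative_at, rule has_vector_derivative_transform_within_open[OF d1 S that])
       (rule L[symmetric])
  then have "vector_derivative (\<lambda>z. vector_derivative ?L (at z)) (at 0) = - of_real (LINT u|?\<nu>. u\<^sup>2)"
    by (intro vector_derivative_at has_vector_derivative_transform_within_open[OF d2 S S0]) simp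
  then show ?thesis
    by (simp add: cumulant_def numeral_2_eq_2)
qed

subsection \<open>Decay of the characteristic function\<close>

lemma Re_levy_exponent:
  assumes "integrable \<nu> (\<lambda>u. iexp (z * u) - 1)"
  shows "Re (CLINT u|\<nu>. iexp (z * u) - 1) = - (LINT u|\<nu>. 1 - cos (z * u))"
proof -
  have "Re (CLINT u|\<nu>. iexp (z * u) - 1) = (LINT u|\<nu>. Re (iexp (z * u) - 1))"
    by (rule integral_Re[OF assms, symmetric])
  also have "\<dots> = (LINT u|\<nu>. - (1 - cos (z * u)))"
    by (simp add: Re_exp)
  finally show ?thesis by (simp only: Bochner_Integration.integral_minus)
qed

text \<open>Only jumps on one side of 0, selected by the sign \<open>s\<close>, with size between
  \<open>1 / \<bar>z\<bar>\<close> and \<open>\<delta>\<close> are kept, and the density there is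
  replaced by \<open>a / u\<close>. If that range is empty, the left-hand side is not positive and
  nothing is to be shown.\<close>

lemma levy_density_one_minus_cos_ge_ln:
  fixes d :: "real \<Rightarrow> real" and s :: real
  assumes [measurable]: "d \<in> borel_measurable borel" and d: "\<And>u. 0 \<le> d u"
    and int: "integrable (density lborel (\<lambda>u. ennreal (d u))) (\<lambda>u. 1 - cos (z * u))"
    and s: "\<bar>s\<bar> = 1" and a: "0 \<le> a" and \<delta>: "0 < \<delta>"
    and lower: "\<And>u. 0 < u \<Longrightarrow> u \<le> \<delta> \<Longrightarrow> a / u \<le> d (s * u)"
    and z: "z \<noteq> 0"
  shows "a * (ln (\<delta> * \<bar>z\<bar>) - 1) \<le> (LINT u|density lborel (\<lambda>u. ennreal (d u)). 1 - cos (z * u))"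
proof (cases "1 \<le> \<delta> * \<bar>z\<bar>")
  case False
  then have "ln (\<delta> * \<bar>z\<bar>) \<le> 0" using \<delta> z by simp
  then have "a * (ln (\<delta> * \<bar>z\<bar>) - 1) \<le> 0" using a by (intro mult_nonneg_nonpos) auto
  also have "0 \<le> (LINT u|density lborel (\<lambda>u. ennreal (d u)). 1 - cos (z * u))" by simp
  finally show ?thesis .
next
  case True
  have "a * (ln (\<delta> * \<bar>z\<bar>) - 1)
      \<le> a * (LINT u|lborel. (1 - cos (\<bar>z\<bar> * u)) / u * indicator {1 / \<bar>z\<bar>..\<delta>} u)"
    using z a True by (intro mult_left_mono integral_one_minus_cos_ge_ln) auto
  also have "\<dots> = (LINT u|lborel. a * ((1 - cos (\<bar>z\<bar> * u)) / u * indicator {1 / \<bar>z\<bar>..\<delta>} u))"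
    by (rule integral_mult_right_zero[symmetric])
  also have "\<dots> \<le> (LINT u|lborel. d (0 + s * u) * (1 - cos (z * (0 + s * u))))"
  proof (rule integral_mono')
    have "integrable lborel (\<lambda>u. d u * (1 - cos (z * u)))"
      using int d by (subst (asm) integrable_density) auto
    then show "integrable lborel (\<lambda>u. d (0 + s * u) * (1 - cos (z * (0 + s * u))))"
      using s by (intro lborel_integrable_real_affine) auto
    show "a * ((1 - cos (\<bar>z\<bar> * u)) / u * indicator {1 / \<bar>z\<bar>..\<delta>} u)
        \<le> d (0 + s * u) * (1 - cos (z * (0 + s * u)))" for u
    proof (cases "u \<in> {1 / \<bar>z\<bar>..\<delta>}")
      case True
      then have "1 / \<bar>z\<bar> \<le> u" "u \<le> \<delta>" by auto
      moreover have "0 < 1 / \<bar>z\<bar>" using z by simp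
      ultimately have u: "0 < u" "u \<le> \<delta>" by linarith+
      have "cos (z * (s * u)) = cos (\<bar>z\<bar> * u)"
        using s cos_abs_real[of "z * (s * u)"] u by (simp add: abs_mult)
      then show ?thesis
        using mult_right_mono[OF lower[OF u], of "1 - cos (\<bar>z\<bar> * u)"] True by simp
    qed (use d in simp)
    show "0 \<le> d (0 + s * u) * (1 - cos (z * (0 + s * u)))" for u
      using d by simp
  qed
  also have "\<dots> = \<bar>s\<bar> *\<^sub>R (LINT u|lborel. d (0 + s * u) * (1 - cos (z * (0 + s * u))))"
    using s by simp
  also have "\<dots> = (LINT u|lborel. d u * (1 - cos (z * u)))"
    using s by (intro lborel_integral_real_affine[symmetric]) auto
  also have "\<dots> = (LINT u|density lborel (\<lambda>u. ennreal (d u)). 1 - cos (z * u))"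
    using d by (subst integral_density) auto
  finally show ?thesis .
qed

text \<open>For \<open>u \<le> 1\<close> it suffices that
  \<open>a * u powr \<alpha> \<le> m * exp (- l)\<close>. If \<open>\<alpha> > 0\<close> this holds
  for all small \<open>u\<close>; if \<open>\<alpha> = 0\<close> the left-hand side does not shrink,
  and \<open>a\<close> itself must be small.\<close>

lemma tempered_density_ge_inverse:
  fixes m l \<alpha> a :: real
  assumes "0 < m" "0 < l" "0 \<le> \<alpha>" "0 < a" "\<alpha> = 0 \<Longrightarrow> a \<le> m * exp (- l)"
  shows "\<exists>\<delta>>0. \<forall>u. 0 < u \<and> u \<le> \<delta> \<longrightarrow> a / u \<le> m / u powr (1 + \<alpha>) * exp (- l * u)"
proof -
  have *: "a / u \<le> m / u powr (1 + \<alpha>) * exp (- l * u)"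
    if u: "0 < u" "u \<le> 1" and le: "a * u powr \<alpha> \<le> m * exp (- l)" for u
  proof -
    have "m * exp (- l) \<le> m * exp (- l * u)" using assms u by simp
    with le have "a * u powr \<alpha> \<le> m * exp (- l * u)" by linarith
    then show ?thesis using u by (simp add: powr_add field_simps)
  qed
  show ?thesis
  proof (cases "\<alpha> = 0")
    case True
    then show ?thesis using assms * by (intro exI[of _ 1]) auto
  next
    case False
    \<comment> \<open>The second entry is the solution \<open>u\<close> of
      \<open>a * u powr \<alpha> = m * exp (- l)\<close>.\<close>
    define \<delta> where "\<delta> = min 1 ((m * exp (- l) / a) powr (1 / \<alpha>))"
    have "\<delta> > 0" using assms by (simp add: \<delta>_def)
    moreover have "a / u \<le> m / u powr (1 + \<alpha>) * exp (- l * u)" if u: "0 < u" "u \<le> \<delta>" for u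
    proof (rule *)
      have "u powr \<alpha> \<le> ((m * exp (- l) / a) powr (1 / \<alpha>)) powr \<alpha>"
        using u assms by (intro powr_mono2) (auto simp: \<delta>_def)
      also have "\<dots> = m * exp (- l) / a"
        using assms False by (simp add: powr_powr)
      finally show "a * u powr \<alpha> \<le> m * exp (- l)" using assms by (simp add: field_simps)
    qed (use u in \<open>auto simp: \<delta>_def\<close>)
    ultimately show ?thesis by blast
  qed
qed

lemma ts_exponent_Re:
  assumes "m1 > 0" "m2 > 0" "l1 > 0" "l2 > 0" "\<alpha>1 < 1" "\<alpha>2 < 1"
  shows "Re (ts_exponent m1 \<alpha>1 l1 m2 \<alpha>2 l2 z) = - (LINT u|ts_levy_measure m1 \<alpha>1 l1 m2 \<alpha>2 l2. 1 - cos (z * u))"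
    and "integrable (ts_levy_measure m1 \<alpha>1 l1 m2 \<alpha>2 l2) (\<lambda>u. 1 - cos (z * u))"
    and "Re (ts_exponent m1 \<alpha>1 l1 m2 \<alpha>2 l2 z) \<le> 0"
proof -
  have "integrable (ts_levy_measure m1 \<alpha>1 l1 m2 \<alpha>2 l2) (\<lambda>u. \<bar>u\<bar> powr 1)"
    using assms by (intro integrable_ts_levy_measure_powr) auto
  then have int: "integrable (ts_levy_measure m1 \<alpha>1 l1 m2 \<alpha>2 l2) (\<lambda>u. iexp (z * u) - 1)"
    by (intro levy_exponent_powr_bound(1)[of _ 1]) auto
  show 1: "Re (ts_exponent m1 \<alpha>1 l1 m2 \<alpha>2 l2 z) = - (LINT u|ts_levy_measure m1 \<alpha>1 l1 m2 \<alpha>2 l2. 1 - cos (z * u))"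
    unfolding ts_exponent_def by (rule Re_levy_exponent[OF int])
  show "Re (ts_exponent m1 \<alpha>1 l1 m2 \<alpha>2 l2 z) \<le> 0"
    unfolding 1 by simp
  have "integrable (ts_levy_measure m1 \<alpha>1 l1 m2 \<alpha>2 l2) (\<lambda>u. - Re (iexp (z * u) - 1))"
    using int by (intro integrable_minus integrable_Re)
  then show "integrable (ts_levy_measure m1 \<alpha>1 l1 m2 \<alpha>2 l2) (\<lambda>u. 1 - cos (z * u))"
    by (simp add: Re_exp)
qed

text \<open>If some stability index is positive, the singularity of the Levy density at \<open>0\<close> beats \<open>a / u\<close>
  for every \<open>a\<close>; otherwise \<open>a\<close> has to be small, which is harmless since then every \<open>2 * a > 0\<close>
  exceeds both indices.\<close>

lemma ts_char_decay:
  assumes pos: "m1 > 0" "m2 > 0" "l1 > 0" "l2 > 0" and \<alpha>: "\<alpha>1 \<in> {0..<1}" "\<alpha>2 \<in> {0..<1}"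
  obtains a K where "0 < a" "a \<le> 1 / 2" "\<alpha>1 < 2 * a" "\<alpha>2 < 2 * a"
    "\<And>z. z \<noteq> 0 \<Longrightarrow> cmod (exp (ts_exponent m1 \<alpha>1 l1 m2 \<alpha>2 l2 z)) \<le> K * \<bar>z\<bar> powr (- a)"
proof -
  let ?d = "ts_levy_density m1 \<alpha>1 l1 m2 \<alpha>2 l2"
  have "\<exists>a s \<delta>. 0 < a \<and> a \<le> 1 / 2 \<and> \<alpha>1 < 2 * a \<and> \<alpha>2 < 2 * a \<and> \<bar>s\<bar> = (1::real) \<and> 0 < \<delta> \<and>
      (\<forall>u. 0 < u \<and> u \<le> \<delta> \<longrightarrow> a / u \<le> ?d (s * u))"
  proof (cases "\<alpha>2 > 0")
    case True
    \<comment> \<open>The negative half-line is singular enough for \<open>a = 1/2\<close>, whatever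
      the index on the other side, since \<open>2 * a = 1\<close> exceeds both indices.\<close>
    obtain \<delta> where "\<delta> > 0" "\<And>u. 0 < u \<Longrightarrow> u \<le> \<delta> \<Longrightarrow> (1/2) / u \<le> m2 / u powr (1 + \<alpha>2) * exp (- l2 * u)"
      using tempered_density_ge_inverse[of m2 l2 \<alpha>2 "1/2"] True pos by auto
    then show ?thesis
      using \<alpha> by (intro exI[of _ "1/2"] exI[of _ "-1"] exI[of _ \<delta>]) (auto simp: ts_levy_density_def)
  next
    case False
    \<comment> \<open>Here \<open>\<alpha>2 = 0\<close> and the positive half-line is used; the
      minimum meets the smallness condition on \<open>a\<close> in the case of a zero index.\<close>
    define a where "a = (if \<alpha>1 > 0 then 1 / 2 else min (1 / 2) (m1 * exp (- l1)))"
    have a: "0 < a" "a \<le> 1 / 2" "\<alpha>1 < 2 * a" "\<alpha>2 < 2 * a"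
      using False \<alpha> pos by (auto simp: a_def)
    obtain \<delta> where "\<delta> > 0" "\<And>u. 0 < u \<Longrightarrow> u \<le> \<delta> \<Longrightarrow> a / u \<le> m1 / u powr (1 + \<alpha>1) * exp (- l1 * u)"
      using tempered_density_ge_inverse[of m1 l1 \<alpha>1 a] \<alpha> pos a by (auto simp: a_def)
    then show ?thesis
      using a by (intro exI[of _ a] exI[of _ 1] exI[of _ \<delta>]) (auto simp: ts_levy_density_def)
  qed
  then obtain a s \<delta> where a: "0 < a" "a \<le> 1 / 2" "\<alpha>1 < 2 * a" "\<alpha>2 < 2 * a"
    and s: "\<bar>s\<bar> = (1::real)" and \<delta>: "0 < \<delta>"
    and lower: "\<And>u. 0 < u \<Longrightarrow> u \<le> \<delta> \<Longrightarrow> a / u \<le> ?d (s * u)" by blast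
  have \<alpha>': "\<alpha>1 < 1" "\<alpha>2 < 1" using \<alpha> by auto
  have "cmod (exp (ts_exponent m1 \<alpha>1 l1 m2 \<alpha>2 l2 z)) \<le> exp a * \<delta> powr (- a) * \<bar>z\<bar> powr (- a)" if z: "z \<noteq> 0" for z
  proof -
    \<comment> \<open>Exponentiating the logarithmic growth of \<open>- Re \<psi>\<close> gives
      polynomial decay of order \<open>a\<close>.\<close>
    have "a * (ln (\<delta> * \<bar>z\<bar>) - 1) \<le> - Re (ts_exponent m1 \<alpha>1 l1 m2 \<alpha>2 l2 z)"
      using levy_density_one_minus_cos_ge_ln[OF measurable_ts_levy_density ts_levy_density_nonneg[OF pos(1,2)]
          ts_exponent_Re(2)[OF pos \<alpha>', unfolded ts_levy_measure_def] s less_imp_le[OF a(1)] \<delta> lower z]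
      unfolding ts_exponent_Re(1)[OF pos \<alpha>'] ts_levy_measure_def by simp
    then have "cmod (exp (ts_exponent m1 \<alpha>1 l1 m2 \<alpha>2 l2 z)) \<le> exp (a - a * ln (\<delta> * \<bar>z\<bar>))"
      by (simp add: algebra_simps)
    also have "\<dots> = exp a * (\<delta> * \<bar>z\<bar>) powr (- a)"
      using \<delta> z by (simp add: powr_def exp_diff exp_minus field_simps)
    finally show ?thesis using \<delta> by (simp add: powr_mult)
  qed
  with a that show thesis by blast
qed

subsection \<open>Gaussian smoothing of distribution functions\<close>

lemma Fubini_integral_bounded:
  fixes f :: "'a \<Rightarrow> 'b \<Rightarrow> 'c::{banach, second_countable_topology}"
  assumes "finite_measure M1" "finite_measure M2"
    and "case_prod f \<in> borel_measurable (M1 \<Otimes>\<^sub>M M2)"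
    and "\<And>x y. norm (f x y) \<le> B"
  shows "(\<integral>x. \<integral>y. f x y \<partial>M2 \<partial>M1) = (\<integral>y. \<integral>x. f x y \<partial>M1 \<partial>M2)"
proof -
  interpret M1: finite_measure M1 by fact
  interpret M2: finite_measure M2 by fact
  interpret pair_sigma_finite M1 M2 ..
  interpret P: finite_measure "M1 \<Otimes>\<^sub>M M2"
    by (intro finite_measure_pair_measure assms)
  have "integrable (M1 \<Otimes>\<^sub>M M2) (case_prod f)"
    by (rule P.integrable_const_bound[of _ B]) (use assms in auto)
  from Fubini_integral[OF this] show ?thesis by simp
qed

text \<open>Since \<open>(\<bar>z\<bar> - 1)\<^sup>2 \<ge> 0\<close>, the normal density is
  dominated by \<open>exp (1/2) * exp (- \<bar>z\<bar>)\<close>. Negative exponents down to -1 are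
  needed for the weights that arise in Fourier space.\<close>

lemma integrable_std_normal_powr:
  assumes "p > -1"
  shows "integrable std_normal_distribution (\<lambda>z. \<bar>z\<bar> powr p)"
proof -
  have "integrable lborel (\<lambda>z. exp (1/2) * (\<bar>z\<bar> powr p * exp (- 1 * \<bar>z\<bar>)))"
    using integrable_powr_exp[of "p + 1" 1] assms by simp
  then have "integrable lborel (\<lambda>z. std_normal_density z *\<^sub>R \<bar>z\<bar> powr p)"
  proof (rule Bochner_Integration.integrable_bound)
    have "std_normal_density z \<le> exp (1/2) * exp (- 1 * \<bar>z\<bar>)" for z
    proof -
      have "1 / sqrt (2 * pi) \<le> 1"
        using pi_gt3 by simp
      moreover have "- z\<^sup>2 / 2 \<le> 1 / 2 - \<bar>z\<bar>"
        using zero_le_power2[of "\<bar>z\<bar> - 1"] by (simp add: power2_diff)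
      ultimately have "1 / sqrt (2 * pi) * exp (- z\<^sup>2 / 2) \<le> 1 * exp (1 / 2 - \<bar>z\<bar>)"
        by (intro mult_mono) auto
      then show ?thesis
        by (simp add: std_normal_density_def exp_add[symmetric])
    qed
    then have "std_normal_density z * \<bar>z\<bar> powr p \<le> exp (1/2) * (\<bar>z\<bar> powr p * exp (- 1 * \<bar>z\<bar>))" for z
      using mult_right_mono[of "std_normal_density z" "exp (1/2) * exp (- 1 * \<bar>z\<bar>)" "\<bar>z\<bar> powr p"]
      by (simp add: mult_ac)
    then show "AE z in lborel. norm (std_normal_density z *\<^sub>R \<bar>z\<bar> powr p)
        \<le> norm (exp (1/2) * (\<bar>z\<bar> powr p * exp (- 1 * \<bar>z\<bar>)))"
      by (intro AE_I2) simp
  qed simp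
  then show ?thesis
    by (subst integrable_density) auto
qed

text \<open>Because \<open>0 powr x = 0\<close>, bounds by negative powers of
  \<open>\<bar>z\<bar>\<close> may fail at 0; this point is a null set.\<close>

lemma AE_std_normal_nonzero: "AE z in std_normal_distribution. z \<noteq> 0"
  using AE_lborel_singleton[of 0] by (subst AE_density) auto

context real_distribution
begin

lemma borel_measurable_cdf [measurable]: "cdf M \<in> borel_measurable borel"
  by (intro borel_measurable_mono monoI cdf_nondecreasing)

text \<open>A Parseval identity: the Gaussian kernel is written as the characteristic function of
  the normal law and the integrals are swapped. It does the work of Fourier inversion with all
  integrands bounded.\<close>

lemma gaussian_kernel_integral_eq_char:
  "complex_of_real (LINT x|M. exp (- (t * (y - x))\<^sup>2 / 2)) =
     (CLINT z|std_normal_distribution. iexp (t * y * z) * char M (- (t * z)))"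
proof -
  interpret N: real_distribution std_normal_distribution by (rule real_dist_normal_dist)
  have [measurable_cong]: "sets M = sets borel" by simp
  have e: "complex_of_real (exp (- s\<^sup>2 / 2)) = (CLINT z|std_normal_distribution. iexp (s * z))" for s
    using fun_cong[OF char_std_normal_distribution, of s] by (simp add: char_def)
  have "complex_of_real (LINT x|M. exp (- (t * (y - x))\<^sup>2 / 2)) =
      (CLINT x|M. CLINT z|std_normal_distribution. iexp (t * (y - x) * z))"
    by (simp only: e flip: integral_complex_of_real)
  also have "\<dots> = (CLINT z|std_normal_distribution. CLINT x|M. iexp (t * (y - x) * z))"
    by (rule Fubini_integral_bounded[where B=1]) (auto intro: finite_measure_axioms N.finite_measure_axioms)
  also have "\<dots> = (CLINT z|std_normal_distribution. iexp (t * y * z) * char M (- (t * z)))"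
  proof (rule Bochner_Integration.integral_cong)
    fix z
    have "(CLINT x|M. iexp (t * (y - x) * z)) = (CLINT x|M. iexp (t * y * z) * iexp (- (t * z) * x))"
      by (simp add: exp_add[symmetric] algebra_simps)
    then show "(CLINT x|M. iexp (t * (y - x) * z)) = iexp (t * y * z) * char M (- (t * z))"
      by (simp add: char_def)
  qed simp
  finally show ?thesis .
qed

text \<open>The indicator of an interval of length \<open>h\<close> is at most
  \<open>exp (1/2)\<close> times a Gaussian kernel of width \<open>h\<close> centred at its left
  end. In Fourier space the decay is evaluated at \<open>z / h\<close>, which produces
  \<open>h powr a\<close>; no density is required.\<close>

lemma cdf_increment_powr_bound:
  assumes K: "\<And>z. z \<noteq> 0 \<Longrightarrow> cmod (char M z) \<le> K * \<bar>z\<bar> powr (- a)"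
    and a: "a < 1" and h: "h > 0"
  shows "cdf M (x + h) - cdf M x
    \<le> exp (1/2) * K * (LINT z|std_normal_distribution. \<bar>z\<bar> powr (- a)) * h powr a"
proof -
  interpret N: real_distribution std_normal_distribution by (rule real_dist_normal_dist)
  have [measurable_cong]: "sets M = sets borel" by simp
  let ?g = "\<lambda>u. exp (- (1 / h * (x - u))\<^sup>2 / 2)"
  have intN: "integrable std_normal_distribution (\<lambda>z. \<bar>z\<bar> powr (- a))"
    using a by (intro integrable_std_normal_powr) simp
  have intg: "integrable M ?g"
    by (rule integrable_const_bound[of _ 1]) auto
  have intc: "integrable std_normal_distribution (\<lambda>z. iexp (1 / h * x * z) * char M (- (1 / h * z)))"
    by (rule N.integrable_const_bound[of _ 1]) (auto simp: norm_mult cmod_char_le_1)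
  have "cdf M (x + h) - cdf M x = (LINT u|M. indicator {x<..x + h} u)"
    using h by (subst cdf_diff_eq) auto
  also have "\<dots> \<le> (LINT u|M. exp (1/2) * ?g u)"
  proof (rule integral_mono)
    fix u
    have "- (1 / 2) \<le> - (1 / h * (x - u))\<^sup>2 / 2" if "u \<in> {x<..x + h}"
    proof -
      have "\<bar>1 / h * (x - u)\<bar> \<le> 1" using that h by (auto simp: field_simps)
      then have "(1 / h * (x - u))\<^sup>2 \<le> 1" by (simp add: abs_square_le_1)
      then show ?thesis by simp
    qed
    then show "indicator {x<..x + h} u \<le> exp (1/2) * ?g u"
      by (auto simp: indicator_def exp_add[symmetric] simp del: power_mult_distrib)
  qed (use intg in \<open>auto intro: integrable_const_bound[of _ 1]\<close>)
  also have "\<dots> = exp (1/2) * cmod (complex_of_real (LINT u|M. ?g u))"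
    by (simp del: power_mult_distrib)
  also have "cmod (complex_of_real (LINT u|M. ?g u))
      \<le> (LINT z|std_normal_distribution. K * h powr a * \<bar>z\<bar> powr (- a))"
    unfolding gaussian_kernel_integral_eq_char
  proof (rule order_trans[OF integral_norm_bound])
    show "(LINT z|std_normal_distribution. cmod (iexp (1 / h * x * z) * char M (- (1 / h * z))))
        \<le> (LINT z|std_normal_distribution. K * h powr a * \<bar>z\<bar> powr (- a))"
    proof (rule integral_mono_AE)
      show "AE z in std_normal_distribution. cmod (iexp (1 / h * x * z) * char M (- (1 / h * z)))
          \<le> K * h powr a * \<bar>z\<bar> powr (- a)"
        using AE_std_normal_nonzero
      proof eventually_elim
        fix z :: real assume "z \<noteq> 0"
        then have "cmod (char M (- (1 / h * z))) \<le> K * \<bar>- (1 / h * z)\<bar> powr (- a)"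
          using h by (intro K) auto
        also have "\<bar>- (1 / h * z)\<bar> powr (- a) = h powr a * \<bar>z\<bar> powr (- a)"
          using h by (simp add: abs_mult powr_divide powr_minus field_simps)
        finally show "cmod (iexp (1 / h * x * z) * char M (- (1 / h * z))) \<le> K * h powr a * \<bar>z\<bar> powr (- a)"
          by (simp add: norm_mult mult_ac)
      qed
    qed (use intc intN in \<open>auto intro!: integrable_norm integrable_mult_right\<close>)
  qed
  finally show ?thesis by (simp add: mult_ac)
qed

text \<open>Both sides are the probability that \<open>x + \<sigma> * z\<close> lies between
  \<open>a\<close> and \<open>b\<close>, for \<open>x\<close> distributed as \<open>M\<close> and an
  independent standard normal \<open>z\<close>: on the left \<open>z\<close> is integrated last, on
  the right the density of the sum is integrated. A bounded interval keeps all measures finite for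
  Fubini.\<close>

lemma gaussian_smoothed_cdf_diff:
  assumes "\<sigma> > 0" "a < b"
  shows "(LINT z|std_normal_distribution. cdf M (b - \<sigma> * z) - cdf M (a - \<sigma> * z)) =
    (LINT y|density lborel (\<lambda>y. ennreal (indicator {a<..b} y)).
       1 / (\<sigma> * sqrt (2 * pi)) * (LINT x|M. exp (- (1 / \<sigma> * (y - x))\<^sup>2 / 2)))"
proof -
  interpret N: real_distribution std_normal_distribution by (rule real_dist_normal_dist)
  have [measurable_cong]: "sets M = sets borel" by simp
  let ?U = "density lborel (\<lambda>y. ennreal (indicator {a<..b} y))"
  interpret U: finite_measure ?U
    using assms by (intro finite_measureI) (auto simp: emeasure_density ennreal_indicator)
  let ?c = "1 / (\<sigma> * sqrt (2 * pi))"
  have normal: "normal_density x \<sigma> y = ?c * exp (- (1 / \<sigma> * (y - x))\<^sup>2 / 2)" for x y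
    using assms by (simp add: normal_density_def real_sqrt_mult field_simps)
  have "(LINT z|std_normal_distribution. cdf M (b - \<sigma> * z) - cdf M (a - \<sigma> * z)) =
      (LINT z|std_normal_distribution. LINT x|M. indicator {a<..b} (x + \<sigma> * z))"
  proof (rule Bochner_Integration.integral_cong)
    fix z
    have "cdf M (b - \<sigma> * z) - cdf M (a - \<sigma> * z) = (LINT x|M. indicator {a - \<sigma> * z<..b - \<sigma> * z} x)"
      using assms by (subst cdf_diff_eq) auto
    also have "\<dots> = (LINT x|M. indicator {a<..b} (x + \<sigma> * z))"
      by (rule Bochner_Integration.integral_cong) (auto simp: indicator_def)
    finally show "cdf M (b - \<sigma> * z) - cdf M (a - \<sigma> * z) = (LINT x|M. indicator {a<..b} (x + \<sigma> * z))" .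
  qed simp
  also have "\<dots> = (LINT x|M. LINT z|std_normal_distribution. indicator {a<..b} (x + \<sigma> * z))"
    by (rule Fubini_integral_bounded[where B=1])
       (auto intro: finite_measure_axioms N.finite_measure_axioms simp: indicator_def)
  also have "\<dots> = (LINT x|M. LINT y|?U. normal_density x \<sigma> y)"
  proof (rule Bochner_Integration.integral_cong)
    fix x
    have scale: "\<sigma> * normal_density x \<sigma> (x + \<sigma> * z) = std_normal_density z" for z
      using assms by (simp add: normal std_normal_density_def)
    have "(LINT y|?U. normal_density x \<sigma> y) = (LINT y|lborel. indicator {a<..b} y * normal_density x \<sigma> y)"
      by (subst integral_density) auto
    also have "\<dots> = \<bar>\<sigma>\<bar> *\<^sub>R (LINT z|lborel. indicator {a<..b} (x + \<sigma> * z) * normal_density x \<sigma> (x + \<sigma> * z))"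
      using assms by (intro lborel_integral_real_affine) simp
    also have "\<dots> = (LINT z|lborel. std_normal_density z * indicator {a<..b} (x + \<sigma> * z))"
      using assms
      by (subst integral_scaleR_right[symmetric]) (simp add: mult_ac flip: scale)
    also have "\<dots> = (LINT z|std_normal_distribution. indicator {a<..b} (x + \<sigma> * z))"
      by (subst integral_density) auto
    finally show "(LINT z|std_normal_distribution. indicator {a<..b} (x + \<sigma> * z)) = (LINT y|?U. normal_density x \<sigma> y)"
      by simp
  qed simp
  also have "\<dots> = (LINT y|?U. LINT x|M. normal_density x \<sigma> y)"
  proof (rule Fubini_integral_bounded[where B="?c"])
    show "norm (normal_density x \<sigma> y) \<le> ?c" for x y
      unfolding normal using assms by (simp add: mult_left_le field_simps del: power_mult_distrib)
    show "(\<lambda>(x, y). normal_density x \<sigma> y) \<in> borel_measurable (M \<Otimes>\<^sub>M ?U)"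
      unfolding normal_density_def by measurable
  qed (auto intro: finite_measure_axioms U.finite_measure_axioms)
  finally show ?thesis
    unfolding normal by simp
qed

end

section \<open>From characteristic functions to smoothed distribution functions\<close>

lemma cmod_integral_iexp_Ioc_le:
  assumes "s \<noteq> 0" "a < b"
  shows "cmod (CLINT y|density lborel (\<lambda>y. ennreal (indicator {a<..b} y)). iexp (s * y)) \<le> 2 / \<bar>s\<bar>"
proof -
  have "(CLINT y|density lborel (\<lambda>y. ennreal (indicator {a<..b} y)). iexp (s * y))
      = (CLINT y:{a<..b}|lborel. iexp (s * y))"
    by (subst integral_density) (auto simp: set_lebesgue_integral_def)
  also have "\<dots> = (CLBINT y=a..b. iexp (s * y))"
    using assms by (simp add: interval_integral_Ioc)
  \<comment> \<open>Evaluating the antiderivative gives a bound that does not depend on the length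
    of the interval, so that \<open>a\<close> can later tend to minus infinity.\<close>
  also have "\<dots> = - \<i> / s * iexp (s * b) - (- \<i> / s * iexp (s * a))"
  proof (rule interval_integral_FTC_finite)
    show "continuous_on {min a b..max a b} (\<lambda>y. iexp (s * y))"
      by (intro continuous_intros)
    show "((\<lambda>y. - \<i> / s * iexp (s * y)) has_vector_derivative iexp (s * y)) (at y within {min a b..max a b})" for y
      using assms
      by (simp only: of_real_mult, intro has_vector_derivative_real_field[where f="\<lambda>w. - \<i> / s * exp (\<i> * (s * w))"])
         (auto intro!: derivative_eq_intros)
  qed
  also have "cmod \<dots> \<le> 1 / \<bar>s\<bar> + 1 / \<bar>s\<bar>"
    by (rule order_trans[OF norm_triangle_ineq4]) (simp add: norm_mult norm_divide)
  finally show ?thesis by simp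
qed

text \<open>The Parseval identity turns the difference into a normal average of
  \<open>char F - char G\<close> at \<open>- z / \<sigma>\<close>, times the Fourier integral of the
  interval. The latter is at most \<open>2 * \<sigma> / \<bar>z\<bar>\<close>, which lowers the
  power of \<open>\<bar>z\<bar>\<close> to \<open>p - 1\<close>, still integrable as
  \<open>p > 0\<close>.\<close>

lemma gaussian_smoothed_increment_bound:
  assumes F: "real_distribution F" and G: "real_distribution G"
    and D: "\<And>z. cmod (char F z - char G z) \<le> A * \<bar>z\<bar> powr p"
    and p: "p > 0" and \<sigma>: "\<sigma> > 0" and ab: "a < b"
  shows "\<bar>(LINT z|std_normal_distribution. cdf F (b - \<sigma> * z) - cdf F (a - \<sigma> * z))
         - (LINT z|std_normal_distribution. cdf G (b - \<sigma> * z) - cdf G (a - \<sigma> * z))\<bar>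
    \<le> A * (LINT z|std_normal_distribution. \<bar>z\<bar> powr (p - 1)) * \<sigma> powr (- p)"
proof -
  interpret F: real_distribution F by fact
  interpret G: real_distribution G by fact
  interpret N: real_distribution std_normal_distribution by (rule real_dist_normal_dist)
  define U where "U = density lborel (\<lambda>y. ennreal (indicator {a<..b} y))"
  have [measurable_cong]: "sets U = sets borel" by (simp add: U_def)
  interpret U: finite_measure U
    unfolding U_def using ab by (intro finite_measureI) (auto simp: emeasure_density ennreal_indicator)
  define c where "c = 1 / (\<sigma> * sqrt (2 * pi))"
  let ?s = "1 / \<sigma>"
  let ?D = "\<lambda>z. char F (- (?s * z)) - char G (- (?s * z))"
  let ?e = "\<lambda>H y. LINT x|H. exp (- (?s * (y - x))\<^sup>2 / 2)"
  have int_e: "integrable U (\<lambda>y. c * ?e H y)" if "real_distribution H" for H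
  proof -
    interpret H: real_distribution H by fact
    have [measurable_cong]: "sets H = sets borel" by simp
    have "norm (?e H y) \<le> 1" for y
    proof -
      have "norm (?e H y) \<le> (LINT x|H. 1)"
        by (rule Bochner_Integration.integral_norm_bound_integral)
           (auto intro!: H.integrable_const_bound[of _ 1])
      then show ?thesis by (simp add: H.prob_space[simplified])
    qed
    then have "integrable U (?e H)"
      by (intro U.integrable_const_bound[of _ 1]) auto
    then show ?thesis by (rule integrable_mult_right)
  qed
  have norm_D: "cmod (iexp x * ?D z) \<le> 2" for x z
    using norm_triangle_ineq4[of "char F (- (?s * z))" "char G (- (?s * z))"]
      F.cmod_char_le_1[of "- (?s * z)"] G.cmod_char_le_1[of "- (?s * z)"]
    by (simp add: norm_mult)
  have int_char: "integrable std_normal_distribution (\<lambda>z. iexp (?s * y * z) * char H (- (?s * z)))"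
    if "real_distribution H" for H y
  proof -
    interpret H: real_distribution H by fact
    show ?thesis
      by (rule N.integrable_const_bound[of _ 1]) (auto simp: norm_mult H.cmod_char_le_1)
  qed
  have "(LINT z|std_normal_distribution. cdf F (b - \<sigma> * z) - cdf F (a - \<sigma> * z))
         - (LINT z|std_normal_distribution. cdf G (b - \<sigma> * z) - cdf G (a - \<sigma> * z))
      = (LINT y|U. c * ?e F y) - (LINT y|U. c * ?e G y)"
    unfolding c_def U_def
    by (simp only: F.gaussian_smoothed_cdf_diff[OF \<sigma> ab] G.gaussian_smoothed_cdf_diff[OF \<sigma> ab])
  also have "\<dots> = (LINT y|U. c * ?e F y - c * ?e G y)"
    using int_e[OF F] int_e[OF G] by (rule Bochner_Integration.integral_diff[symmetric])
  finally have eq: "(LINT z|std_normal_distribution. cdf F (b - \<sigma> * z) - cdf F (a - \<sigma> * z))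
         - (LINT z|std_normal_distribution. cdf G (b - \<sigma> * z) - cdf G (a - \<sigma> * z))
      = (LINT y|U. c * ?e F y - c * ?e G y)" .
  have "complex_of_real (LINT y|U. c * ?e F y - c * ?e G y)
      = (CLINT y|U. c * (CLINT z|std_normal_distribution. iexp (?s * y * z) * ?D z))"
    unfolding integral_complex_of_real[symmetric]
  proof (rule Bochner_Integration.integral_cong)
    fix y
    have "complex_of_real (c * ?e F y - c * ?e G y)
        = c * (complex_of_real (?e F y) - complex_of_real (?e G y))"
      by (simp add: algebra_simps del: power_mult_distrib)
    also have "complex_of_real (?e F y) - complex_of_real (?e G y)
        = (CLINT z|std_normal_distribution. iexp (?s * y * z) * ?D z)"
      unfolding F.gaussian_kernel_integral_eq_char G.gaussian_kernel_integral_eq_char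
        Bochner_Integration.integral_diff[OF int_char[OF F] int_char[OF G], symmetric]
      by (simp only: right_diff_distrib)
    finally show "complex_of_real (c * ?e F y - c * ?e G y)
        = c * (CLINT z|std_normal_distribution. iexp (?s * y * z) * ?D z)" .
  qed simp
  also have "\<dots> = c * (CLINT y|U. CLINT z|std_normal_distribution. iexp (?s * y * z) * ?D z)"
    by (rule integral_mult_right_zero)
  also have "(CLINT y|U. CLINT z|std_normal_distribution. iexp (?s * y * z) * ?D z)
      = (CLINT z|std_normal_distribution. CLINT y|U. iexp (?s * y * z) * ?D z)"
  proof (rule Fubini_integral_bounded)
    show "cmod (iexp (?s * y * z) * ?D z) \<le> 2" for y z by (rule norm_D)
    show "finite_measure U" "finite_measure std_normal_distribution"
      by (rule U.finite_measure_axioms N.finite_measure_axioms)+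
    show "(\<lambda>(y, z). iexp (?s * y * z) * ?D z) \<in> borel_measurable (U \<Otimes>\<^sub>M std_normal_distribution)"
      by auto
  qed
  also have "\<dots> = (CLINT z|std_normal_distribution. ?D z * (CLINT y|U. iexp (?s * z * y)))"
    unfolding integral_mult_right_zero[symmetric] by (simp only: mult.commute mult.left_commute)
  finally have eq': "complex_of_real (LINT y|U. c * ?e F y - c * ?e G y)
      = c * (CLINT z|std_normal_distribution. ?D z * (CLINT y|U. iexp (?s * z * y)))" .
  have "0 \<le> c" using \<sigma> by (simp add: c_def)
  have "\<bar>LINT y|U. c * ?e F y - c * ?e G y\<bar> = cmod (complex_of_real (LINT y|U. c * ?e F y - c * ?e G y))"
    by (simp only: norm_of_real)
  also have "\<dots> = c * cmod (CLINT z|std_normal_distribution. ?D z * (CLINT y|U. iexp (?s * z * y)))"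
    unfolding eq' norm_mult using \<open>0 \<le> c\<close> by simp
  also have "\<dots> \<le> c * (LINT z|std_normal_distribution. 2 * A * \<sigma> powr (1 - p) * \<bar>z\<bar> powr (p - 1))"
  proof (rule mult_left_mono)
    have int: "integrable std_normal_distribution (\<lambda>z. 2 * A * \<sigma> powr (1 - p) * \<bar>z\<bar> powr (p - 1))"
      using p by (intro integrable_mult_right integrable_std_normal_powr) simp
    have le: "AE z in std_normal_distribution. cmod (?D z * (CLINT y|U. iexp (?s * z * y)))
        \<le> 2 * A * \<sigma> powr (1 - p) * \<bar>z\<bar> powr (p - 1)"
      using AE_std_normal_nonzero
    proof eventually_elim
      fix z :: real assume z: "z \<noteq> 0"
      have "cmod (?D z * (CLINT y|U. iexp (?s * z * y)))
          \<le> (A * \<bar>- (?s * z)\<bar> powr p) * (2 / \<bar>?s * z\<bar>)"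
        unfolding norm_mult U_def
        using z \<sigma> ab by (intro mult_mono D cmod_integral_iexp_Ioc_le order_trans[OF norm_ge_zero D]) auto
      also have "\<bar>- (?s * z)\<bar> powr p = \<bar>z\<bar> powr p * \<sigma> powr (- p)"
        using \<sigma> by (simp add: abs_mult powr_divide powr_minus field_simps)
      also have "2 / \<bar>?s * z\<bar> = 2 * \<sigma> powr 1 * \<bar>z\<bar> powr (- 1)"
        using \<sigma> z by (simp add: abs_mult powr_minus field_simps)
      also have "A * (\<bar>z\<bar> powr p * \<sigma> powr (- p)) * (2 * \<sigma> powr 1 * \<bar>z\<bar> powr (- 1))
          = 2 * A * (\<sigma> powr 1 * \<sigma> powr (- p)) * (\<bar>z\<bar> powr p * \<bar>z\<bar> powr (- 1))"
        by simp
      finally show "cmod (?D z * (CLINT y|U. iexp (?s * z * y))) \<le> 2 * A * \<sigma> powr (1 - p) * \<bar>z\<bar> powr (p - 1)"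
        by (simp only: powr_add[symmetric] add_uminus_conv_diff)
    qed
    have "integrable std_normal_distribution (\<lambda>z. ?D z * (CLINT y|U. iexp (?s * z * y)))"
      by (rule Bochner_Integration.integrable_bound[OF int]) (use le in auto)
    then show "cmod (CLINT z|std_normal_distribution. ?D z * (CLINT y|U. iexp (?s * z * y)))
        \<le> (LINT z|std_normal_distribution. 2 * A * \<sigma> powr (1 - p) * \<bar>z\<bar> powr (p - 1))"
      by (intro order_trans[OF integral_norm_bound integral_mono_AE[OF _ int le]] integrable_norm)
  qed fact
  also have "\<dots> = 2 / sqrt (2 * pi) * (A * (LINT z|std_normal_distribution. \<bar>z\<bar> powr (p - 1)) * \<sigma> powr (- p))"
  proof -
    have "\<sigma> powr (1 - p) = \<sigma> * \<sigma> powr (- p)"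
      using \<sigma> powr_add[of \<sigma> 1 "- p"] by simp
    then show ?thesis using \<sigma> by (simp add: c_def)
  qed
  \<comment> \<open>The numerical factor left over from the normal density is below 1 and is
    dropped.\<close>
  also have "\<dots> \<le> 1 * (A * (LINT z|std_normal_distribution. \<bar>z\<bar> powr (p - 1)) * \<sigma> powr (- p))"
  proof (rule mult_right_mono)
    have "2 \<le> sqrt (2 * pi)" using pi_gt3 by (simp add: real_le_rsqrt)
    then show "2 / sqrt (2 * pi) \<le> 1" by simp
    have "0 \<le> A" using order_trans[OF norm_ge_zero D[of 1]] by simp
    then show "0 \<le> A * (LINT z|std_normal_distribution. \<bar>z\<bar> powr (p - 1)) * \<sigma> powr (- p)"
      by simp
  qed
  finally show ?thesis unfolding eq by (simp only: mult_1)
qed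

text \<open>The increment bound is uniform in the left endpoint, which is sent to minus infinity;
  both smoothed distribution functions vanish there by dominated convergence.\<close>

lemma gaussian_smoothed_cdf_bound:
  assumes F: "real_distribution F" and G: "real_distribution G"
    and D: "\<And>z. cmod (char F z - char G z) \<le> A * \<bar>z\<bar> powr p"
    and p: "p > 0" and \<sigma>: "\<sigma> > 0"
  shows "\<bar>LINT z|std_normal_distribution. cdf F (y - \<sigma> * z) - cdf G (y - \<sigma> * z)\<bar>
    \<le> A * (LINT z|std_normal_distribution. \<bar>z\<bar> powr (p - 1)) * \<sigma> powr (- p)" (is "_ \<le> ?E")
proof -
  interpret F: real_distribution F by fact
  interpret G: real_distribution G by fact
  interpret N: real_distribution std_normal_distribution by (rule real_dist_normal_dist)
  let ?I = "\<lambda>y. LINT z|std_normal_distribution. cdf F (y - \<sigma> * z) - cdf G (y - \<sigma> * z)"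
  have int: "integrable std_normal_distribution (\<lambda>z. cdf F (x - \<sigma> * z))"
     "integrable std_normal_distribution (\<lambda>z. cdf G (x - \<sigma> * z))" for x
    by (auto intro!: N.integrable_const_bound[of _ 1] simp: F.cdf_nonneg F.cdf_bounded_prob G.cdf_nonneg G.cdf_bounded_prob)
  have incr: "\<bar>?I y - ?I a\<bar> \<le> ?E" if "a < y" for a
    using gaussian_smoothed_increment_bound[OF F G D p \<sigma> that] int
    by (simp add: algebra_simps)
  have tail: "(\<lambda>n. LINT z|std_normal_distribution. cdf H (- real n - \<sigma> * z)) \<longlonglongrightarrow> 0"
    if "real_distribution H" for H
  proof -
    interpret H: real_distribution H by fact
    have "(\<lambda>n. LINT z|std_normal_distribution. cdf H (- real n - \<sigma> * z)) \<longlonglongrightarrow> (LINT z|std_normal_distribution. 0)"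
    proof (rule integral_dominated_convergence[where w="\<lambda>_. 1"])
      have "(\<lambda>n. cdf H (- real n - \<sigma> * z)) \<longlonglongrightarrow> 0" for z
        by (rule filterlim_compose[OF H.cdf_lim_at_bot]) real_asymp
      then show "AE z in std_normal_distribution. (\<lambda>n. cdf H (- real n - \<sigma> * z)) \<longlonglongrightarrow> 0"
        by simp
    qed (auto simp: H.cdf_nonneg H.cdf_bounded_prob)
    then show ?thesis by simp
  qed
  have "(\<lambda>n. ?I (- real n)) \<longlonglongrightarrow> 0 - 0"
    using tendsto_diff[OF tail[OF F] tail[OF G]] int by simp
  then have "(\<lambda>n. \<bar>?I y - ?I (- real n)\<bar>) \<longlonglongrightarrow> \<bar>?I y - (0 - 0)\<bar>"
    by (intro tendsto_intros)
  moreover have "eventually (\<lambda>n. \<bar>?I y - ?I (- real n)\<bar> \<le> ?E) sequentially"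
  proof -
    have "eventually (\<lambda>n. - real n < y) sequentially" by real_asymp
    then show ?thesis by eventually_elim (rule incr)
  qed
  ultimately show ?thesis
    using tendsto_upperbound[OF _ _ trivial_limit_sequentially, of "\<lambda>n. \<bar>?I y - ?I (- real n)\<bar>" "\<bar>?I y - (0 - 0)\<bar>" ?E]
    by (simp only: diff_zero)
qed

section \<open>Removing the smoothing\<close>

lemma unsmoothing_step:
  fixes h :: "'a \<Rightarrow> real"
  assumes "prob_space N" and [measurable]: "h \<in> borel_measurable N" "S \<in> sets N"
    and h: "\<And>z. z \<in> S \<Longrightarrow> \<eta> - q \<le> h z" "\<And>z. \<bar>h z\<bar> \<le> D"
    and E: "(LINT z|N. h z) \<le> E" "0 \<le> E" and p: "measure N S \<ge> 2 / 3" and "0 \<le> q"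
  shows "\<eta> \<le> q + 3 / 2 * E + D / 2"
proof -
  interpret N: prob_space N by fact
  have "0 \<le> D" using h(2)[of undefined] by linarith
  have ind: "integrable N (indicator B :: 'a \<Rightarrow> real)" if "B \<in> sets N" for B
    using that by (intro N.integrable_const_bound[of _ 1]) auto
  \<comment> \<open>\<open>h\<close> is at least \<open>\<eta> - q\<close> on \<open>S\<close> and
    at least \<open>- D\<close> elsewhere. With mass 2/3 on \<open>S\<close>, solving for
    \<open>\<eta>\<close> leaves \<open>D\<close> with the coefficient 1/2, small enough to be
    absorbed later.\<close>
  have "(LINT z|N. (\<eta> - q) * indicator S z - D * indicator (space N - S) z) \<le> (LINT z|N. h z)"
  proof (rule integral_mono)
    show "integrable N h" using h by (intro N.integrable_const_bound[of _ D]) auto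
    show "(\<eta> - q) * indicator S z - D * indicator (space N - S) z \<le> h z" if "z \<in> space N" for z
      using h(1)[of z] h(2)[of z] that by (auto simp: indicator_def)
  qed (auto intro!: Bochner_Integration.integrable_diff integrable_mult_right ind)
  also have "(LINT z|N. (\<eta> - q) * indicator S z - D * indicator (space N - S) z)
      = (\<eta> - q) * measure N S - D * (1 - measure N S)"
    by (subst Bochner_Integration.integral_diff)
       (auto intro!: integrable_mult_right ind simp: N.prob_compl)
  finally have 1: "(\<eta> - q) * measure N S - D * (1 - measure N S) \<le> E" using E by simp
  have 2: "D * (1 - measure N S) \<le> D * (1 / 3)"
    using p \<open>0 \<le> D\<close> by (intro mult_left_mono) auto
  show ?thesis
  proof (cases "q \<le> \<eta>")
    case True
    then have "(\<eta> - q) * (2 / 3) \<le> (\<eta> - q) * measure N S" using p by (intro mult_left_mono) auto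
    with 1 2 show ?thesis by (simp add: field_simps)
  next
    case False
    with E \<open>0 \<le> D\<close> show ?thesis by simp
  qed
qed

text \<open>Where \<open>F - G\<close> is large at \<open>x\<close>, monotonicity of \<open>F\<close> and the modulus of continuity of \<open>G\<close>
  keep it large on an interval of length \<open>2 k \<sigma>\<close> next to \<open>x\<close>, so the smoothed difference is large too.\<close>

lemma cdf_diff_le_smoothed:
  assumes F: "real_distribution F" and G: "real_distribution G" and "real_distribution N"
    and E: "\<And>y. \<bar>LINT z|N. cdf F (y - \<sigma> * z) - cdf G (y - \<sigma> * z)\<bar> \<le> E"
    and q: "\<And>x. cdf G (x + 2 * k * \<sigma>) - cdf G x \<le> q"
    and k: "measure N {-k<..k} \<ge> 2 / 3" and \<sigma>: "\<sigma> > 0"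
  shows "\<bar>cdf F x - cdf G x\<bar> \<le> 3 * E + 2 * q"
proof -
  interpret F: real_distribution F by fact
  interpret G: real_distribution G by fact
  interpret N: real_distribution N by fact
  have [measurable_cong]: "sets N = sets borel" by simp
  define H where "H = (\<lambda>x. cdf F x - cdf G x)"
  have [measurable]: "H \<in> borel_measurable borel" unfolding H_def by measurable
  have H1: "\<bar>H x\<bar> \<le> 1" for x
    using F.cdf_nonneg[of x] F.cdf_bounded_prob[of x] G.cdf_nonneg[of x] G.cdf_bounded_prob[of x]
    by (simp add: H_def abs_le_iff)
  \<comment> \<open>The sought distance itself serves as the crude bound where the normal variable
    is large.\<close>
  define D where "D = (SUP x. \<bar>H x\<bar>)"
  have bdd: "bdd_above (range (\<lambda>x. \<bar>H x\<bar>))" using H1 by (intro bdd_aboveI2)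
  have HD: "\<bar>H x\<bar> \<le> D" for x unfolding D_def by (rule cSUP_upper[OF _ bdd]) simp
  have "k > 0"
  proof (rule ccontr)
    assume "\<not> k > 0"
    then have "{-k<..k} = {}" by auto
    with k show False by simp
  qed
  have E0: "0 \<le> E" using E[of 0] by linarith
  have q0: "0 \<le> q"
    using q[of 0] G.cdf_nondecreasing[of 0 "2 * k * \<sigma>"] \<open>k > 0\<close> \<sigma> by simp
  have "\<bar>H x\<bar> \<le> q + 3 / 2 * E + D / 2" for x
  proof (cases "0 \<le> H x")
    case True
    \<comment> \<open>The smoothed difference is taken at \<open>x + k * \<sigma>\<close>, so that
      for \<open>z\<close> in the central interval the argument of \<open>H\<close> lies between
      \<open>x\<close> and \<open>x + 2 * k * \<sigma>\<close>.\<close>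
    have "H x \<le> q + 3 / 2 * E + D / 2"
    proof (rule unsmoothing_step[OF N.prob_space_axioms _ _ _ _ _ E0 k q0])
      show "H x - q \<le> H (x + k * \<sigma> - \<sigma> * z)" if "z \<in> {-k<..k}" for z
      proof -
        let ?y = "x + k * \<sigma> - \<sigma> * z"
        have "\<sigma> * z \<le> \<sigma> * k" "\<sigma> * (- k) \<le> \<sigma> * z"
          using that \<sigma> mult_left_mono[of z k \<sigma>] mult_left_mono[of "- k" z \<sigma>] by auto
        then have "x \<le> ?y" "?y \<le> x + 2 * k * \<sigma>" by (auto simp: algebra_simps)
        then show ?thesis
          using F.cdf_nondecreasing[of x ?y] G.cdf_nondecreasing[of ?y "x + 2 * k * \<sigma>"] q[of x]
          by (simp add: H_def)
      qed
      show "(LINT z|N. H (x + k * \<sigma> - \<sigma> * z)) \<le> E"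
        using E[of "x + k * \<sigma>"] by (simp add: H_def abs_le_iff)
    qed (use HD in auto)
    with True show ?thesis by simp
  next
    case False
    \<comment> \<open>Mirror image: where \<open>G\<close> exceeds \<open>F\<close>, the points to
      the left of \<open>x\<close> are the useful ones.\<close>
    have "- H x \<le> q + 3 / 2 * E + D / 2"
    proof (rule unsmoothing_step[OF N.prob_space_axioms _ _ _ _ _ E0 k q0])
      show "- H x - q \<le> - H (x - k * \<sigma> - \<sigma> * z)" if "z \<in> {-k<..k}" for z
      proof -
        let ?y = "x - k * \<sigma> - \<sigma> * z"
        have "\<sigma> * z \<le> \<sigma> * k" "\<sigma> * (- k) \<le> \<sigma> * z"
          using that \<sigma> mult_left_mono[of z k \<sigma>] mult_left_mono[of "- k" z \<sigma>] by auto
        then have "?y \<le> x" "x \<le> ?y + 2 * k * \<sigma>" by (auto simp: algebra_simps)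
        then show ?thesis
          using F.cdf_nondecreasing[of ?y x] G.cdf_nondecreasing[of x "?y + 2 * k * \<sigma>"] q[of ?y]
          by (simp add: H_def)
      qed
      show "(LINT z|N. - H (x - k * \<sigma> - \<sigma> * z)) \<le> E"
        unfolding Bochner_Integration.integral_minus using E[of "x - k * \<sigma>"] by (simp add: H_def abs_le_iff)
    qed (use HD in auto)
    with False show ?thesis by simp
  qed
  \<comment> \<open>\<open>D\<close> is finite, so half of it can be moved to the left, which gives
    \<open>D \<le> 3 * E + 2 * q\<close>.\<close>
  then have "D \<le> q + 3 / 2 * E + D / 2"
    unfolding D_def by (intro cSUP_least) auto
  then show ?thesis using HD[of x] by (simp add: H_def)
qed

lemma std_normal_concentrated:
  "\<exists>k::real. k > 0 \<and> measure std_normal_distribution {-k<..k} \<ge> 2 / 3"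
proof -
  interpret N: real_distribution std_normal_distribution by (rule real_dist_normal_dist)
  have "(\<lambda>n. cdf std_normal_distribution (real n) - cdf std_normal_distribution (- real n)) \<longlonglongrightarrow> 1 - 0"
    by (intro tendsto_diff N.cdf_lim_infty_prob N.cdf_lim_neg_infty)
  then have "eventually (\<lambda>n. 2 / 3 < cdf std_normal_distribution (real n) - cdf std_normal_distribution (- real n)) sequentially"
    by (rule order_tendstoD) simp
  then have "eventually (\<lambda>n. 2 / 3 < measure std_normal_distribution {- real n<..real n} \<and> 0 < n) sequentially"
    using eventually_gt_at_top[of 0]
    by eventually_elim (subst (asm) N.cdf_diff_eq, auto)
  then obtain n :: nat where "2 / 3 < measure std_normal_distribution {- real n<..real n}" "0 < n"
    using eventually_happens by fastforce
  then show ?thesis by (intro exI[of _ "real n"]) auto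
qed

subsection \<open>Compound Poisson approximation\<close>

text \<open>On the convex left half-plane the derivative of \<open>exp\<close> has modulus at most
  1.\<close>

lemma cmod_exp_diff_le:
  assumes "Re a \<le> 0" "Re b \<le> 0"
  shows "cmod (exp a - exp b) \<le> cmod (a - b)"
proof -
  have "cmod (exp a - exp b) \<le> 1 * cmod (a - b)"
  proof (rule field_differentiable_bound[where S="{w. Re w \<le> 0}" and f'=exp])
    show "convex {w. Re w \<le> 0}" by (rule convex_halfspace_Re_le)
  qed (use assms in \<open>auto intro!: derivative_eq_intros\<close>)
  then show ?thesis by simp
qed

text \<open>The derivative \<open>exp v - 1\<close> of \<open>exp v - v\<close> is bounded by
  \<open>cmod v\<close> in the left half-plane, hence by \<open>cmod w\<close> on its convex
  intersection with the ball of that radius.\<close>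

lemma cmod_exp_minus_one_minus_le:
  assumes "Re w \<le> 0"
  shows "cmod (exp w - 1 - w) \<le> (cmod w)\<^sup>2"
proof -
  let ?S = "{v. Re v \<le> 0} \<inter> cball 0 (cmod w)"
  have "cmod ((exp w - w) - (exp 0 - 0)) \<le> cmod w * cmod (w - 0)"
  proof (rule field_differentiable_bound[where S="?S" and f'="\<lambda>v. exp v - 1"])
    show "convex ?S" by (intro convex_Int convex_halfspace_Re_le convex_cball)
    show "cmod (exp v - 1) \<le> cmod w" if "v \<in> ?S" for v
      using that cmod_exp_diff_le[of v 0] by auto
  qed (use assms in \<open>auto intro!: derivative_eq_intros\<close>)
  then show ?thesis by (simp add: power2_eq_square algebra_simps)
qed

text \<open>With \<open>v = w / n\<close> both exponents have nonpositive real part and differ by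
  \<open>n * (exp v - 1 - v)\<close>, of size at most \<open>n * (cmod v)\<^sup>2\<close>.\<close>

lemma cmod_compound_poisson_exp_diff_le:
  assumes "Re w \<le> 0" "n \<ge> 1"
  shows "cmod (exp (of_nat n * (exp (1 / of_nat n * w) - 1)) - exp w) \<le> (cmod w)\<^sup>2 / real n"
proof -
  define v where "v = 1 / of_nat n * w"
  have w: "w = of_nat n * v" using assms by (simp add: v_def)
  have v: "Re v \<le> 0" using assms by (simp add: v_def divide_nonpos_nonneg)
  have "Re (exp v) \<le> 1"
    using complex_Re_le_cmod[of "exp v"] v by (simp add: order_trans[of _ "exp (Re v)"])
  then have "Re (of_nat n * (exp v - 1)) \<le> 0" by (simp add: mult_nonneg_nonpos)
  then have "cmod (exp (of_nat n * (exp v - 1)) - exp w) \<le> cmod (of_nat n * (exp v - 1) - w)"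
    using assms by (intro cmod_exp_diff_le)
  also have "of_nat n * (exp v - 1) - w = of_nat n * (exp v - 1 - v)"
    by (simp add: w algebra_simps)
  also have "cmod \<dots> \<le> n * (cmod v)\<^sup>2"
    using cmod_exp_minus_one_minus_le[OF v] by (simp add: norm_mult mult_left_mono)
  also have "\<dots> = (cmod w)\<^sup>2 / n"
    using assms by (simp add: w norm_mult power2_eq_square)
  finally show ?thesis by (simp add: v_def)
qed

section \<open>Choice of the smoothing scale and of the constant\<close>

theorem theorem4p1:
  fixes m1 \<alpha>1 l1 m2 \<alpha>2 l2 :: real
    and M :: "'a measure" and X :: "'a \<Rightarrow> real"
    and N :: "nat \<Rightarrow> 'b measure" and Xn :: "nat \<Rightarrow> 'b \<Rightarrow> real"
  assumes "m1 > 0" and "m2 > 0" and "l1 > 0" and "l2 > 0"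
    and "\<alpha>1 \<in> {0..<1}" and "\<alpha>2 \<in> {0..<1}"
    and "prob_space M"
    and "has_TSD M X m1 \<alpha>1 l1 m2 \<alpha>2 l2"
    and "\<And>n. n \<ge> 1 \<Longrightarrow> prob_space (N n)"
    and "\<And>n. n \<ge> 1 \<Longrightarrow> compound_poisson_rv (N n) (Xn n)"
    and "\<And>n z. n \<ge> 1 \<Longrightarrow>
           char (distr (N n) borel (Xn n)) z =
             exp (of_nat n * (ts_char_root n m1 \<alpha>1 l1 m2 \<alpha>2 l2 z - 1))"
  shows "\<exists>c>0. \<forall>n\<ge>1.
           kolmogorov_dist (N n) (Xn n) M X
             \<le> c * (\<Sum>j=1..2. cmod (cumulant M X j)) powr (2/5) * (1 / real n) powr (1/5)"
proof -
  note pos = assms(1-4)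
  have \<alpha>': "\<alpha>1 < 1" "\<alpha>2 < 1" using assms(5,6) by auto
  let ?\<nu> = "ts_levy_measure m1 \<alpha>1 l1 m2 \<alpha>2 l2"
  define \<psi> where "\<psi> = ts_exponent m1 \<alpha>1 l1 m2 \<alpha>2 l2"
  define G where "G = distr M borel X"
  define F where "F = (\<lambda>n. distr (N n) borel (Xn n))"
  have G: "real_distribution G" and charG: "char G z = exp (\<psi> z)" for z
    using assms(7,8) by (auto simp: G_def has_TSD_def \<psi>_def intro!: prob_space.real_distribution_distr)
  interpret G: real_distribution G by (rule G)
  have F: "real_distribution (F n)" if "n \<ge> 1" for n
    using assms(9,10)[OF that] by (auto simp: F_def compound_poisson_rv_def intro!: prob_space.real_distribution_distr)
  obtain a K where a: "0 < a" "a \<le> 1 / 2" "\<alpha>1 < 2 * a" "\<alpha>2 < 2 * a"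
    and K: "\<And>z. z \<noteq> 0 \<Longrightarrow> cmod (exp (\<psi> z)) \<le> K * \<bar>z\<bar> powr (- a)"
    unfolding \<psi>_def using ts_char_decay[OF pos assms(5,6)] by metis
  define P where "P = 2 * (LINT u|?\<nu>. \<bar>u\<bar> powr (2 * a))"
  \<comment> \<open>The exponent \<open>2 * a\<close> is admissible from both sides: it exceeds the
    indices, for integrability, and is at most 1, for the interpolation bound.\<close>
  have \<psi>: "cmod (\<psi> z) \<le> P * \<bar>z\<bar> powr (2 * a)" for z
    unfolding \<psi>_def ts_exponent_def P_def
    using a pos by (intro levy_exponent_powr_bound(2) integrable_ts_levy_measure_powr) auto
  have char_diff: "cmod (char (F n) z - char G z) \<le> P\<^sup>2 / n * \<bar>z\<bar> powr (4 * a)" if n: "n \<ge> 1" for n z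
  proof -
    have "cmod (char (F n) z - char G z) \<le> (cmod (\<psi> z))\<^sup>2 / n"
      using cmod_compound_poisson_exp_diff_le[OF ts_exponent_Re(3)[OF pos \<alpha>'] n] assms(11)[OF n]
      by (simp add: F_def charG \<psi>_def ts_char_root_def)
    also have "\<dots> \<le> (P * \<bar>z\<bar> powr (2 * a))\<^sup>2 / n"
      by (intro divide_right_mono power_mono \<psi>) auto
    also have "\<dots> = P\<^sup>2 / n * \<bar>z\<bar> powr (4 * a)"
      by (simp add: power_mult_distrib power2_eq_square powr_add[symmetric])
    finally show ?thesis .
  qed
  define J where "J = (LINT z|std_normal_distribution. \<bar>z\<bar> powr (4 * a - 1))"
  define Q where "Q = exp (1/2) * K * (LINT z|std_normal_distribution. \<bar>z\<bar> powr (- a))"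
  have Q: "cdf G (x + h) - cdf G x \<le> Q * h powr a" if "h > 0" for x h
    unfolding Q_def using a K that by (intro G.cdf_increment_powr_bound) (auto simp: charG)
  obtain k :: real where k: "k > 0" "measure std_normal_distribution {-k<..k} \<ge> 2 / 3"
    using std_normal_concentrated by blast
  \<comment> \<open>This is \<open>3 * E + 2 * q\<close> from the unsmoothing lemma with the common
    factor \<open>(1 / real n) powr (1/5)\<close> taken out; it does not depend on
    \<open>n\<close>.\<close>
  define C where "C = 3 * P\<^sup>2 * J + 2 * Q * (2 * k) powr a"
  have dist: "kolmogorov_dist (N n) (Xn n) M X \<le> C * (1 / real n) powr (1/5)" if n: "n \<ge> 1" for n
  proof -
    define \<sigma> where "\<sigma> = (1 / real n) powr (1 / (5 * a))"
    have \<sigma>: "\<sigma> > 0" using n by (simp add: \<sigma>_def)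
    have \<sigma>a: "\<sigma> powr a = (1 / real n) powr (1 / 5)"
      using a by (simp add: \<sigma>_def powr_powr)
    have \<sigma>4: "1 / real n * \<sigma> powr (- (4 * a)) = (1 / real n) powr (1 / 5)"
    proof -
      have "\<sigma> powr (- (4 * a)) = (1 / real n) powr (- (4 / 5))"
        using a by (simp add: \<sigma>_def powr_powr)
      then have "1 / real n * \<sigma> powr (- (4 * a)) = (1 / real n) powr (1 + - (4 / 5))"
        unfolding powr_add using n by simp
      then show ?thesis by simp
    qed
    have bound: "\<bar>cdf (F n) x - cdf G x\<bar>
        \<le> 3 * (P\<^sup>2 / n * J * \<sigma> powr (- (4 * a))) + 2 * (Q * (2 * k * \<sigma>) powr a)" for x
    proof (rule cdf_diff_le_smoothed[OF F[OF n] G real_dist_normal_dist _ _ k(2) \<sigma>])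
      show "\<bar>LINT z|std_normal_distribution. cdf (F n) (y - \<sigma> * z) - cdf G (y - \<sigma> * z)\<bar>
          \<le> P\<^sup>2 / n * J * \<sigma> powr (- (4 * a))" for y
        unfolding J_def using a by (intro gaussian_smoothed_cdf_bound F[OF n] G char_diff[OF n] \<sigma>) auto
      show "cdf G (x + 2 * k * \<sigma>) - cdf G x \<le> Q * (2 * k * \<sigma>) powr a" for x
        using k \<sigma> by (intro Q) auto
    qed
    have "3 * (P\<^sup>2 / n * J * \<sigma> powr (- (4 * a))) + 2 * (Q * (2 * k * \<sigma>) powr a)
        = 3 * P\<^sup>2 * J * (1 / real n * \<sigma> powr (- (4 * a))) + 2 * (Q * ((2 * k) powr a * \<sigma> powr a))"
      by (simp add: powr_mult)
    also have "\<dots> = C * (1 / real n) powr (1/5)"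
      unfolding \<sigma>4 \<sigma>a C_def by (simp add: algebra_simps)
    finally have "\<bar>cdf (F n) x - cdf G x\<bar> \<le> C * (1 / real n) powr (1/5)" for x
      using bound[of x] by (simp only:)
    then show ?thesis
      unfolding kolmogorov_dist_def F_def G_def by (intro cSUP_least) auto
  qed
  define S where "S = (\<Sum>j=1..2. cmod (cumulant M X j))"
  have "cmod (cumulant M X 2) > 0"
    using ts_second_moment_pos[OF pos \<alpha>'] cumulant_2_TSD[OF pos \<alpha>' assms(8)] by simp
  also have "cmod (cumulant M X 2) \<le> S"
    unfolding S_def by (rule member_le_sum) auto
  finally have S: "S > 0" .
  show ?thesis
  \<comment> \<open>Using \<open>\<bar>C\<bar> + 1\<close> makes the witness positive without
    examining the sign of \<open>C\<close>; dividing by \<open>S powr (2/5)\<close> cancels the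
    cumulant factor.\<close>
  proof (intro exI[of _ "(\<bar>C\<bar> + 1) / S powr (2/5)"] conjI allI impI)
    show "(\<bar>C\<bar> + 1) / S powr (2/5) > 0" using S by (intro divide_pos_pos) auto
    fix n :: nat assume n: "n \<ge> 1"
    have "kolmogorov_dist (N n) (Xn n) M X \<le> (\<bar>C\<bar> + 1) * (1 / real n) powr (1/5)"
      by (rule order_trans[OF dist[OF n] mult_right_mono]) auto
    also have "\<dots> = (\<bar>C\<bar> + 1) / S powr (2/5) * S powr (2/5) * (1 / real n) powr (1/5)"
      using S by simp
    finally show "kolmogorov_dist (N n) (Xn n) M X
        \<le> (\<bar>C\<bar> + 1) / S powr (2/5) * (\<Sum>j=1..2. cmod (cumulant M X j)) powr (2/5) * (1 / real n) powr (1/5)"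
      by (simp only: S_def)
  qed
qed

end
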